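(* Suppose that $A_1,\dots,A_k\in SL(2n,\mathbb{R})$, with only positive eigenvalues, are such that the attracting and repulsing spaces $C_{A_i}^{\pm}\subset\mathbb{R}\mathbf{P}^{2n-1}$, $i=1,\dots,k$, are all $(n-1)$-dimensional and pairwise disjoint. Then there exists an integer $M>0$ such that the group $\Gamma=\langle A_1^M,\dots,A_k^M\rangle$ is a Schottky group of rank $k$.
   Context: For $A\in SL(N,\mathbb{R})$ with only positive eigenvalues, the attracting and repulsing subspaces of $\mathbb{R}\mathbf{P}^{N-1}$ are $$C_A^+=span_{\lambda_i>1}(\mathbf{v}_i)/\mathbb{R}^\times,\qquad C_A^-=span_{0<\lambda_j<1}(\mathbf{v}_j)/\mathbb{R}^\times,$$ where $\mathbf{v}_i$ denotes the eigenvector of $A^T$ associated with the eigenvalue $\lambda_i$; dimensions are projective dimensions. All $2k$ spaces $C_{A_i}^+,C_{A_i}^-$ are required to be pairwise disjoint. $\mathcal{P}(N)=\{X\in Sym_N(\mathbb{R}):\det X=1,\ X>0\}$ with action $g.X=g^TXg$ of $SL(N,\mathbb{R})$; $s(X,Y)=\mathrm{tr}(X^{-1}Y)$; the Dirichlet-Selberg domain of a discrete subgroup $\Gamma<SL(N,\mathbb{R})$ centered at $X$ is $DS(X,\Gamma)=\{Y\in\mathcal{P}(N): s(X,Y)\le s(g.X,Y)\ \forall g\in\Gamma\}$, a convex polyhedron (intersection of a locally finite collection of closed half-spaces $\{Y:\mathrm{tr}(AY)\ge0\}$). A facet of a convex polyhedron $P$ is a maximal subset of $\partial P$ which is itself a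 convex polyhedron; faces are $P$, and inductively facets of faces; a ridge is a codimension-$2$ face. A discrete subgroup $\Gamma<SL(N,\mathbb{R})$ is a Schottky group of rank $k$ if there exists $X\in\mathcal{P}(N)$ such that $DS(X,\Gamma)$ is $2k$-sided (has exactly $2k$ facets) and is ridge free (has no ridges). *)

theory Defs
  imports "HOL-Analysis.Analysis" "HOL-Algebra.Generated_Groups"
begin

section \<open>The group SL and its action on positive definite matrices\<close>

definition SL :: "(real^'n^'n) monoid" where
  "SL = \<lparr>carrier = {A. det A = 1}, monoid.mult = (**), one = mat 1\<rparr>"

lemma group_SL: "group (SL :: (real^'n^'n) monoid)"
proof (rule groupI)
  fix A :: "real^'n^'n"
  assume "A \<in> carrier SL"
  then have "det A = 1"
    by (simp add: SL_def)
  then obtain B where B: "B ** A = mat 1"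
    by (metis invertible_det_nz invertible_left_inverse zero_neq_one)
  then have "det B * det A = 1"
    by (metis det_I det_mul)
  with B \<open>det A = 1\<close> show "\<exists>B\<in>carrier SL. B \<otimes>\<^bsub>SL\<^esub> A = \<one>\<^bsub>SL\<^esub>"
    by (auto simp: SL_def)
qed (auto simp: SL_def det_mul matrix_mul_assoc)

definition Sym :: "(real^'n^'n) set" where
  "Sym = {X. transpose X = X}"

definition PD :: "(real^'n^'n) set" where
  "PD = {X \<in> Sym. det X = 1 \<and> (\<forall>v. v \<noteq> 0 \<longrightarrow> 0 < v \<bullet> (X *v v))}"

definition act :: "real^'n^'n \<Rightarrow> real^'n^'n \<Rightarrow> real^'n^'n" where
  "act g X = transpose g ** X ** g"

definition selberg :: "real^'n^'n \<Rightarrow> real^'n^'n \<Rightarrow> real" where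
  "selberg X Y = trace (matrix_inv X ** Y)"

definition DS :: "real^'n^'n \<Rightarrow> (real^'n^'n) set \<Rightarrow> (real^'n^'n) set" where
  "DS X \<Gamma> = {Y \<in> PD. \<forall>g\<in>\<Gamma>. selberg X Y \<le> selberg (act g X) Y}"


section \<open>Convex polyhedra in the space of positive definite matrices\<close>

definition half_space :: "real^'n^'n \<Rightarrow> (real^'n^'n) set" where
  "half_space A = {Y \<in> PD. 0 \<le> trace (A ** Y)}"

definition bounding_plane :: "real^'n^'n \<Rightarrow> (real^'n^'n) set" where
  "bounding_plane A = {Y \<in> PD. trace (A ** Y) = 0}"

text \<open>
  Local finiteness of a collection of half-spaces refers, as usual for polyhedra, to their
  bounding hyperplanes: an interior point of the intersection lies in all of the half-spaces
  themselves, and there may be infinitely many. The empty collection gives the whole space.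
\<close>

definition convex_polyhedron :: "(real^'n^'n) set \<Rightarrow> bool" where
  "convex_polyhedron P \<longleftrightarrow>
     (\<exists>\<A>. \<A> \<subseteq> Sym - {0} \<and>
          locally_finite_in (top_of_set PD) (bounding_plane ` \<A>) \<and>
          P = PD \<inter> (\<Inter>A\<in>\<A>. half_space A))"

text \<open>
  The smallest plane containing \<open>P\<close> is \<open>span P \<inter> PD\<close>. Planes are cut out of \<open>PD\<close> by linear
  subspaces, so the dimension of the plane is one less than that of the subspace.
\<close>

definition poly_dim :: "(real^'n^'n) set \<Rightarrow> int" where
  "poly_dim P = int (dim P) - 1"

text \<open>The boundary is taken relative to the smallest plane containing the polyhedron.\<close>

definition poly_boundary :: "(real^'n^'n) set \<Rightarrow> (real^'n^'n) set" where
  "poly_boundary P = (top_of_set (span P \<inter> PD)) frontier_of P"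

text \<open>
  The empty set is an intersection of half-spaces (take \<open>A\<close> negative definite), but it does not
  count as a facet; otherwise every polyhedron with empty boundary would have a facet.
\<close>

definition poly_facet_of :: "(real^'n^'n) set \<Rightarrow> (real^'n^'n) set \<Rightarrow> bool" where
  "poly_facet_of F P \<longleftrightarrow>
     F \<noteq> {} \<and> convex_polyhedron F \<and> F \<subseteq> poly_boundary P \<and>
     (\<forall>G. convex_polyhedron G \<and> F \<subseteq> G \<and> G \<subseteq> poly_boundary P \<longrightarrow> G = F)"

inductive poly_face_of :: "(real^'n^'n) set \<Rightarrow> (real^'n^'n) set \<Rightarrow> bool" where
  self: "poly_face_of P P"
| facet: "poly_face_of F P \<Longrightarrow> poly_facet_of G F \<Longrightarrow> poly_face_of G P"

definition ridge_of :: "(real^'n^'n) set \<Rightarrow> (real^'n^'n) set \<Rightarrow> bool" where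
  "ridge_of R P \<longleftrightarrow> poly_face_of R P \<and> poly_dim R = poly_dim P - 2"


section \<open>Schottky groups\<close>

definition discrete_subgroup :: "(real^'n^'n) set \<Rightarrow> bool" where
  "discrete_subgroup \<Gamma> \<longleftrightarrow> subgroup \<Gamma> SL \<and> discrete \<Gamma>"

definition schottky_group :: "nat \<Rightarrow> (real^'n^'n) set \<Rightarrow> bool" where
  "schottky_group k \<Gamma> \<longleftrightarrow>
     discrete_subgroup \<Gamma> \<and>
     (\<exists>X\<in>PD. finite {F. poly_facet_of F (DS X \<Gamma>)} \<and>
             card {F. poly_facet_of F (DS X \<Gamma>)} = 2 * k \<and>
             (\<nexists>R. ridge_of R (DS X \<Gamma>)))"


section \<open>Attracting and repulsing subspaces\<close>

definition eigenvector :: "'a::field^'n^'n \<Rightarrow> 'a^'n \<Rightarrow> 'a \<Rightarrow> bool" where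
  "eigenvector A v c \<longleftrightarrow> v \<noteq> 0 \<and> A *v v = c *s v"

text \<open>All complex eigenvalues are real and positive.\<close>

definition only_positive_eigenvalues :: "real^'n^'n \<Rightarrow> bool" where
  "only_positive_eigenvalues A \<longleftrightarrow>
     (\<forall>c v. eigenvector (map_matrix complex_of_real A) v c \<longrightarrow>
            (\<exists>r>0. c = complex_of_real r))"

text \<open>
  A point of real projective space is a line \<open>span {v}\<close> with \<open>v \<noteq> 0\<close>, and the projectivization of
  a linear subspace is the set of lines in it. The union of these lines recovers the (nonzero)
  linear subspace.
\<close>

definition projectivization :: "(real^'n) set \<Rightarrow> (real^'n) set set" where
  "projectivization V = {span {v} | v. v \<in> V \<and> v \<noteq> 0}"

definition proj_dim :: "(real^'n) set set \<Rightarrow> int" where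
  "proj_dim C = int (dim (\<Union>C)) - 1"

definition attracting :: "real^'n^'n \<Rightarrow> (real^'n) set set" where
  "attracting A = projectivization (span {v. \<exists>c>1. eigenvector (transpose A) v c})"

definition repulsing :: "real^'n^'n \<Rightarrow> (real^'n) set set" where
  "repulsing A = projectivization (span {v. \<exists>c. 0 < c \<and> c < 1 \<and> eigenvector (transpose A) v c})"

end

theory Submission
  imports Defs
begin

text \<open>
  Center the domain at the identity. For \<open>g\<close> a large power of some \<open>A i\<close> or of its inverse, the
  forbidden set \<open>{Y. tr (g g\<^sup>T Y) \<le> tr Y}\<close> consists of matrices concentrated near the contracted
  subspace of \<open>g\<^sup>T\<close>. These subspaces meet trivially, so for two distinct letters \<open>g, h\<close> eventually
  \<open>g g\<^sup>T + h h\<^sup>T \<ge> 4\<close>, and the forbidden sets are pairwise disjoint. Ping-pong on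
  the function \<open>tr\<close> then shows that reduced words impose no further condition on the domain, so it
  is bounded by \<open>2 k\<close> pairwise disjoint hyperplanes. Each of these is a facet without boundary.
\<close>

section \<open>Positive definite matrices\<close>

text \<open>The form of \<open>g ** transpose g\<close> at \<open>v\<close> is the squared norm of
  \<open>v v* g\<close>, the transpose of \<open>g\<close> applied to \<open>v\<close>. This is why
  eigenvectors of the transposes decide which matrices lose trace. The attracting and repulsing
  spaces of one \<open>A i\<close> both have linear dimension \<open>n\<close> and meet trivially,
  so their eigenvectors span everything. Hence every vector outside the repulsing space grows under
  the powers of the transpose of \<open>A i\<close>, and for the inverse the two spaces swap roles.
  The subspaces that fail to grow, one for each of the \<open>2 * k\<close> letters, are then
  exactly the given disjoint spaces. Any constant above 2 could replace 4: if \<open>g\<close> does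
  not increase the trace of \<open>Y\<close>, the inequality leaves at least
  \<open>3 * trace Y\<close> for \<open>h\<close>. The same inequality shows that the
  \<open>2 * k\<close> letters are distinct matrices, and the strict trace gap at the identity gives
  discreteness.\<close>

definition posdef :: "real^'n^'n \<Rightarrow> bool" where
  "posdef Y \<longleftrightarrow> Y \<in> Sym \<and> (\<forall>v. v \<noteq> 0 \<longrightarrow> 0 < v \<bullet> (Y *v v))"

lemma PD_iff: "Y \<in> PD \<longleftrightarrow> posdef Y \<and> det Y = 1"
  by (auto simp: PD_def posdef_def)

lemma subspace_Sym: "subspace Sym"
  by (auto simp: subspace_def Sym_def transpose_def vec_eq_iff)

lemma mat_1_Sym: "mat 1 \<in> Sym"
  by (simp add: Sym_def)

lemma Sym_inner: "Y \<in> Sym \<Longrightarrow> v \<bullet> (Y *v w) = w \<bullet> (Y *v v)"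
  unfolding Sym_def mem_Collect_eq by (metis dot_lmul_matrix inner_commute transpose_matrix_vector)

lemma inner_matrix_add_scaleR:
  "v \<bullet> ((Y + c *\<^sub>R Z) *v v) = v \<bullet> (Y *v v) + c * (v \<bullet> (Z *v v))" for Y Z :: "real^'n^'n"
  by (simp add: matrix_vector_mult_add_rdistrib inner_add_right
      flip: scaleR_matrix_vector_assoc)

lemma posdef_mat_1: "posdef (mat 1)"
  by (simp add: posdef_def mat_1_Sym)

lemma posdef_add: "posdef Y \<Longrightarrow> posdef Z \<Longrightarrow> posdef (Y + Z)"
  using inner_matrix_add_scaleR[of _ Y 1 Z]
  by (auto simp: posdef_def subspace_add[OF subspace_Sym] add_pos_pos)

lemma posdef_scaleR: "posdef Y \<Longrightarrow> 0 < c \<Longrightarrow> posdef (c *\<^sub>R Y)"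
  using inner_matrix_add_scaleR[of _ 0 c Y]
  by (auto simp: posdef_def subspace_scale[OF subspace_Sym])

lemma posdef_segment:
  assumes "posdef Y" "posdef Z" "0 \<le> t" "t \<le> 1"
  shows "posdef ((1 - t) *\<^sub>R Y + t *\<^sub>R Z)"
proof (cases "t = 0 \<or> t = 1")
  case False
  then show ?thesis using assms by (intro posdef_add posdef_scaleR) auto
qed (use assms in auto)

lemma linear_trace_mult: "linear (\<lambda>Y. trace (E ** Y))" for E :: "real^'n^'n"
  by (rule linearI) (simp_all add: trace_def matrix_matrix_mult_def sum.distrib sum_distrib_left
      algebra_simps)

lemmas trace_mult_add = linear_add[OF linear_trace_mult]
  and trace_mult_scaleR = linear_cmul[OF linear_trace_mult]

lemma continuous_on_trace_mult: "continuous_on S (\<lambda>Y. trace (E ** Y))" for E :: "real^'n^'n"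
  using linear_trace_mult linear_continuous_on linear_conv_bounded_linear by blast

lemma continuous_on_det: "continuous_on S (det :: real^'n^'n \<Rightarrow> real)"
  unfolding det_def by (intro continuous_intros)

text \<open>If the determinant were not positive, it would vanish somewhere on the segment from the
  identity to \<open>Y\<close>. That segment stays positive definite, and a positive definite matrix
  has trivial kernel.\<close>

lemma posdef_det_pos:
  assumes "posdef Y"
  shows "0 < det Y"
proof (rule ccontr)
  let ?p = "\<lambda>t. (1 - t) *\<^sub>R mat 1 + t *\<^sub>R Y"
  assume neg: "\<not> 0 < det Y"
  have "continuous_on {0..1::real} (\<lambda>t. det (?p t))"
    by (rule continuous_on_compose2[OF continuous_on_det[of UNIV]]) (auto intro!: continuous_intros)
  with neg have "\<exists>t\<ge>0. t \<le> 1 \<and> det (?p t) = 0"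
    by (intro IVT2') auto
  then obtain t where t: "0 \<le> t" "t \<le> 1" "det (?p t) = 0" by blast
  then obtain v where "v \<noteq> 0" "?p t *v v = 0"
    by (metis invertible_det_nz invertible_left_inverse matrix_left_invertible_ker)
  then show False
    using posdef_segment[OF posdef_mat_1 assms t(1,2)] by (force simp: posdef_def)
qed

text \<open>
  Since \<open>PD\<close> is a slice of the convex cone of positive definite matrices and half-spaces are
  cones, this replaces straight segments, which leave \<open>PD\<close>, by their radial projections.
\<close>

definition normalize_det :: "real^'n^'n \<Rightarrow> real^'n^'n" where
  "normalize_det Y = root CARD('n) (1 / det Y) *\<^sub>R Y"

lemma normalize_det_scaling:
  fixes Y :: "real^'n^'n"
  assumes "posdef Y"
  obtains c where "0 < c" "normalize_det Y = c *\<^sub>R Y"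
  using posdef_det_pos[OF assms] that[of "root CARD('n) (1 / det Y)"]
  by (simp add: normalize_det_def real_root_gt_zero)

lemma det_scaleR: "det (c *\<^sub>R Y) = c ^ CARD('n) * det Y" for Y :: "real^'n^'n"
  by (simp add: det_def prod.distrib sum_distrib_left ac_simps)

lemma normalize_det_PD:
  assumes "posdef Y"
  shows "normalize_det Y \<in> PD"
proof -
  obtain c where "0 < c" "normalize_det Y = c *\<^sub>R Y"
    using normalize_det_scaling[OF assms] .
  then have "posdef (normalize_det Y)" by (simp add: assms posdef_scaleR)
  moreover have "det (normalize_det Y) = 1"
    using posdef_det_pos[OF assms] by (simp add: normalize_det_def det_scaleR)
  ultimately show ?thesis by (simp add: PD_iff)
qed

lemma normalize_det_eq: "Y \<in> PD \<Longrightarrow> normalize_det Y = Y"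
  by (simp add: PD_iff normalize_det_def)

lemma continuous_on_normalize_det: "continuous_on (Collect posdef) normalize_det"
proof -
  have "continuous_on (Collect posdef) (\<lambda>Y. root CARD('n) (1 / det (Y :: real^'n^'n)) *\<^sub>R Y)"
    using posdef_det_pos by (fastforce intro!: continuous_intros continuous_on_det)
  then show ?thesis by (simp add: normalize_det_def[abs_def])
qed

lemma trace_normalize_det:
  assumes "posdef Y"
  shows "0 \<le> trace (E ** normalize_det Y) \<longleftrightarrow> 0 \<le> trace (E ** Y)"
    and "trace (E ** normalize_det Y) = 0 \<longleftrightarrow> trace (E ** Y) = 0"
proof -
  obtain c where "0 < c" "normalize_det Y = c *\<^sub>R Y"
    using normalize_det_scaling[OF assms] .
  then show "0 \<le> trace (E ** normalize_det Y) \<longleftrightarrow> 0 \<le> trace (E ** Y)"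
    and "trace (E ** normalize_det Y) = 0 \<longleftrightarrow> trace (E ** Y) = 0"
    by (simp_all add: trace_mult_scaleR zero_le_mult_iff)
qed

text \<open>The unit sphere is compact, so the form of \<open>Y\<close> has a positive minimum
  there, which outweighs a small multiple of the form of \<open>Z\<close>. This supplies the room to
  move that the span computations need.\<close>

lemma posdef_perturb:
  assumes "posdef Y" "Z \<in> Sym"
  obtains e where "0 < e" "\<And>t. 0 \<le> t \<Longrightarrow> t \<le> e \<Longrightarrow> posdef (Y + t *\<^sub>R Z)"
proof -
  let ?S = "sphere 0 1 :: (real^'n) set"
  have nonempty: "?S \<noteq> {}" by auto
  have cont: "continuous_on ?S (\<lambda>v. v \<bullet> (X *v v))" for X :: "real^'n^'n"
    by (intro continuous_intros linear_continuous_on matrix_vector_mul_bounded_linear)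
  obtain v0 where v0: "v0 \<in> ?S" "\<And>v. v \<in> ?S \<Longrightarrow> v0 \<bullet> (Y *v v0) \<le> v \<bullet> (Y *v v)"
    using continuous_attains_inf[OF compact_sphere nonempty cont] by metis
  obtain v1 where v1: "v1 \<in> ?S" "\<And>v. v \<in> ?S \<Longrightarrow> v1 \<bullet> (Z *v v1) \<le> v \<bullet> (Z *v v)"
    using continuous_attains_inf[OF compact_sphere nonempty cont] by metis
  \<comment> \<open>The form of \<open>Z\<close> is at least \<open>- K\<close> on the sphere, and
    adding 1 keeps \<open>K\<close> positive. Up to time \<open>m / (2 * K)\<close> at most half of
    the minimum \<open>m\<close> is lost.\<close>
  define m K where "m = v0 \<bullet> (Y *v v0)" and "K = \<bar>v1 \<bullet> (Z *v v1)\<bar> + 1"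
  have "0 < m" using assms(1) v0(1) unfolding posdef_def m_def by (metis norm_zero sphere_eq_empty mem_sphere_0 zero_neq_one)
  have "0 < K" by (simp add: K_def)
  show thesis
  proof (rule that[of "m / (2 * K)"])
    show "0 < m / (2 * K)" using \<open>0 < m\<close> \<open>0 < K\<close> by simp
    fix t assume t: "0 \<le> t" "t \<le> m / (2 * K)"
    have unit: "0 < v \<bullet> ((Y + t *\<^sub>R Z) *v v)" if "v \<in> ?S" for v
    proof -
      have "t * K \<le> m / 2" using t(2) \<open>0 < K\<close> by (simp add: field_simps)
      moreover have "t * (- K) \<le> t * (v \<bullet> (Z *v v))"
        using v1(2)[OF that] t(1) by (intro mult_left_mono) (auto simp: K_def)
      moreover have "m \<le> v \<bullet> (Y *v v)" using v0(2)[OF that] by (simp add: m_def)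
      ultimately show ?thesis using \<open>0 < m\<close> by (simp add: inner_matrix_add_scaleR)
    qed
    have "0 < v \<bullet> ((Y + t *\<^sub>R Z) *v v)" if "v \<noteq> 0" for v
    proof -
      have "0 < sgn v \<bullet> ((Y + t *\<^sub>R Z) *v sgn v)"
        using that by (intro unit) (simp add: norm_sgn)
      also have "\<dots> = (inverse (norm v))\<^sup>2 * (v \<bullet> ((Y + t *\<^sub>R Z) *v v))"
        by (simp add: sgn_div_norm matrix_vector_mult_scaleR power2_eq_square)
      finally show ?thesis using that by (simp add: zero_less_mult_iff)
    qed
    then show "posdef (Y + t *\<^sub>R Z)"
      using assms by (auto simp: posdef_def intro!: subspace_add[OF subspace_Sym] subspace_scale[OF subspace_Sym])
  qed
qed

section \<open>Traces of products of positive semidefinite matrices\<close>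

lemma trace_mult_outer: "trace (Q ** (\<chi> i j. u $ i * u $ j)) = u \<bullet> (Q *v u)" for Q :: "real^'n^'n"
  by (simp add: trace_def matrix_matrix_mult_def matrix_vector_mult_def inner_vec_def
      sum_distrib_left mult_ac)

lemma outer_mult_vector: "(\<chi> i j. u $ i * u $ j) *v v = (u \<bullet> v) *\<^sub>R u" for u v :: "real^'n"
  by (simp add: vec_eq_iff matrix_vector_mult_def inner_vec_def sum_distrib_left mult_ac)

text \<open>
  Splitting off the rank one part \<open>u u\<^sup>T / (w \<bullet> u)\<close> with \<open>u = Y w\<close> keeps \<open>Y\<close> positive
  semidefinite and enlarges its kernel.
\<close>

lemma trace_mult_nonneg:
  fixes Q Y :: "real^'n^'n"
  assumes "Y \<in> Sym" "\<And>v. 0 \<le> v \<bullet> (Y *v v)" "\<And>v. 0 \<le> v \<bullet> (Q *v v)"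
  shows "0 \<le> trace (Q ** Y)"
  using assms(1,2)
proof (induction "CARD('n) - dim {v. Y *v v = 0}" arbitrary: Y rule: less_induct)
  \<comment> \<open>The induction is on the rank of \<open>Y\<close>, with \<open>Q\<close>
    fixed.\<close>
  case less
  show ?case
  proof (cases "\<forall>w. w \<bullet> (Y *v w) = 0")
    case True
    have "v \<bullet> (Y *v w) = 0" for v w
      using True[rule_format, of "v + w"] True[rule_format, of v] True[rule_format, of w]
        Sym_inner[OF less.prems(1), of v w]
      by (simp add: matrix_vector_right_distrib inner_add_left inner_add_right)
    then have "Y = 0"
      by (metis inner_eq_zero_iff matrix_eq matrix_vector_mult_0)
    then show ?thesis using linear_0[OF linear_trace_mult, of Q] by (metis order_refl)
  next
    case False
    then obtain w where w: "w \<bullet> (Y *v w) > 0"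
      using less.prems(2) by (metis order_le_less)
    define \<alpha> u where "\<alpha> = w \<bullet> (Y *v w)" and "u = Y *v w"
    define Y' where "Y' = Y + (- 1 / \<alpha>) *\<^sub>R (\<chi> i j. u $ i * u $ j)"
    have "\<alpha> > 0" using w by (simp add: \<alpha>_def)
    have Y'v: "Y' *v v = Y *v v - ((u \<bullet> v) / \<alpha>) *\<^sub>R u" for v
      unfolding Y'_def matrix_vector_mult_add_rdistrib scaleR_matrix_vector_assoc[symmetric]
        outer_mult_vector by simp
    have uv: "u \<bullet> v = w \<bullet> (Y *v v)" for v
      unfolding u_def by (metis Sym_inner[OF less.prems(1)] inner_commute)
    have "{v. Y *v v = 0} \<subset> {v. Y' *v v = 0}"
    proof
      show "{v. Y *v v = 0} \<subseteq> {v. Y' *v v = 0}"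
        by (auto simp: Y'v uv)
      have "Y' *v w = 0" using \<open>\<alpha> > 0\<close> uv[of w] by (simp add: Y'v \<alpha>_def u_def)
      moreover have "Y *v w \<noteq> 0" using w by auto
      ultimately show "{v. Y *v v = 0} \<noteq> {v. Y' *v v = 0}" by blast
    qed
    moreover have sub: "subspace {v. X *v v = 0}" for X :: "real^'n^'n"
      by (rule linear_subspace_kernel) (rule matrix_vector_mul_linear)
    ultimately have "dim {v. Y *v v = 0} < dim {v. Y' *v v = 0}"
      by (intro dim_psubset) (simp add: span_eq_iff[THEN iffD2])
    moreover have "dim {v. Y' *v v = 0} \<le> CARD('n)"
      using dim_subset_UNIV[of "{v. Y' *v v = 0}"] by simp
    ultimately have decr: "CARD('n) - dim {v. Y' *v v = 0} < CARD('n) - dim {v. Y *v v = 0}"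
      by linarith
    have "0 \<le> v \<bullet> (Y' *v v)" for v
    proof -
      let ?c = "(w \<bullet> (Y *v v)) / \<alpha>"
      \<comment> \<open>As in the proof of Cauchy-Schwarz: \<open>v - ?c *\<^sub>R w\<close> is
        orthogonal to \<open>w\<close> for the form of \<open>Y\<close>, and the value of that form
        there is the value of the form of \<open>Y'\<close> at \<open>v\<close>.\<close>
      have "0 \<le> (v - ?c *\<^sub>R w) \<bullet> (Y *v (v - ?c *\<^sub>R w))" by (rule less.prems(2))
      also have "\<dots> = v \<bullet> (Y *v v) - 2 * ?c * (w \<bullet> (Y *v v)) + ?c * ?c * \<alpha>"
        using Sym_inner[OF less.prems(1), of v w]
        by (simp add: matrix_vector_mult_diff_distrib inner_diff_left inner_diff_right
            matrix_vector_mult_scaleR \<alpha>_def algebra_simps)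
      also have "\<dots> = v \<bullet> (Y *v v) - ?c * (w \<bullet> (Y *v v))"
        using \<open>\<alpha> > 0\<close> by (simp add: field_simps)
      also have "\<dots> = v \<bullet> (Y' *v v)"
        using inner_commute[of v u] uv[of v] by (simp add: Y'v inner_diff_right)
      finally show ?thesis .
    qed
    moreover have "Y' \<in> Sym"
      unfolding Y'_def using less.prems(1)
      by (intro subspace_add[OF subspace_Sym] subspace_scale[OF subspace_Sym])
        (auto simp: Sym_def transpose_def vec_eq_iff)
    ultimately have "0 \<le> trace (Q ** Y')" by (intro less.hyps decr)
    moreover have "trace (Q ** Y) = trace (Q ** Y') + (u \<bullet> (Q *v u)) / \<alpha>"
      by (simp only: Y'_def trace_mult_add trace_mult_scaleR trace_mult_outer) simp
    ultimately show ?thesis using assms(3)[of u] \<open>\<alpha> > 0\<close> by simp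
  qed
qed

lemma trace_posdef_pos:
  assumes "posdef Y"
  shows "0 < trace Y"
proof -
  have "Y $ i $ i = axis i 1 \<bullet> (Y *v axis i 1)" for i
    by (simp add: inner_axis' matrix_vector_mult_basis column_def)
  then have "0 < Y $ i $ i" for i
    using assms by (simp add: posdef_def axis_eq_0_iff)
  then show ?thesis by (auto simp: trace_def intro!: sum_pos)
qed

section \<open>Polyhedra with pairwise disjoint walls\<close>

text \<open>Since \<open>trace (E i)\<close> is the value of the \<open>i\<close>-th functional at
  the identity, \<open>trace_E_pos\<close> puts the identity strictly inside every half-space. With
  \<open>ex_negative\<close> each functional changes sign on the cone, and \<open>separated\<close>
  makes the closed complements pairwise disjoint.\<close>

locale separated_half_spaces =
  fixes I :: "'i set" and E :: "'i \<Rightarrow> real^'n^'n"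
  assumes finite_I: "finite I"
    and E_Sym: "i \<in> I \<Longrightarrow> E i \<in> Sym"
    and trace_E_pos: "i \<in> I \<Longrightarrow> 0 < trace (E i)"
    and ex_negative: "i \<in> I \<Longrightarrow> \<exists>Y. posdef Y \<and> trace (E i ** Y) < 0"
    and separated: "i \<in> I \<Longrightarrow> j \<in> I \<Longrightarrow> i \<noteq> j \<Longrightarrow> posdef Y \<Longrightarrow>
      trace (E i ** Y) \<le> 0 \<Longrightarrow> 0 < trace (E j ** Y)"
begin

definition P :: "(real^'n^'n) set" where
  "P = PD \<inter> (\<Inter>i\<in>I. half_space (E i))"

lemma mem_P: "Y \<in> P \<longleftrightarrow> Y \<in> PD \<and> (\<forall>i\<in>I. 0 \<le> trace (E i ** Y))"
  by (auto simp: P_def half_space_def)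

lemma posdef_mem_P: "posdef Y \<Longrightarrow> normalize_det Y \<in> P \<longleftrightarrow> (\<forall>i\<in>I. 0 \<le> trace (E i ** Y))"
  by (simp add: mem_P normalize_det_PD trace_normalize_det)

lemma bounding_plane_nonneg:
  assumes "i \<in> I" "j \<in> I" "Y \<in> bounding_plane (E i)"
  shows "0 \<le> trace (E j ** Y)"
  using separated[OF assms(1,2), of Y] assms(3)
  by (cases "i = j") (auto simp: bounding_plane_def PD_iff)

lemma bounding_plane_subset_P: "i \<in> I \<Longrightarrow> bounding_plane (E i) \<subseteq> P"
  using bounding_plane_nonneg by (auto simp: mem_P bounding_plane_def)

lemma bounding_plane_disjoint:
  "i \<in> I \<Longrightarrow> j \<in> I \<Longrightarrow> i \<noteq> j \<Longrightarrow> bounding_plane (E i) \<inter> bounding_plane (E j) = {}"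
  using separated[of i j] by (fastforce simp: bounding_plane_def PD_iff)

lemma bounding_plane_nonempty:
  assumes "i \<in> I"
  shows "bounding_plane (E i) \<noteq> {}"
proof -
  obtain Y where Y: "posdef Y" "trace (E i ** Y) < 0"
    using ex_negative[OF assms] by blast
  let ?a = "trace (E i)" and ?b = "trace (E i ** Y)"
  \<comment> \<open>The zero of the affine function that runs from \<open>?a > 0\<close> at the
    identity to \<open>?b < 0\<close> at \<open>Y\<close>.\<close>
  define t where "t = ?a / (?a - ?b)"
  have t: "0 \<le> t" "t \<le> 1" "(1 - t) * ?a + t * ?b = 0"
    using trace_E_pos[OF assms] Y(2) by (auto simp: t_def field_simps)
  let ?Z = "(1 - t) *\<^sub>R mat 1 + t *\<^sub>R Y"
  have pd: "posdef ?Z" by (rule posdef_segment[OF posdef_mat_1 Y(1) t(1,2)])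
  have "trace (E i ** ?Z) = 0"
    using t(3) by (simp add: trace_mult_add trace_mult_scaleR)
  then have "normalize_det ?Z \<in> bounding_plane (E i)"
  by (simp add: bounding_plane_def normalize_det_PD[OF pd] trace_normalize_det[OF pd])
  then show ?thesis by blast
qed

lemma inj_on_bounding_plane: "inj_on (\<lambda>i. bounding_plane (E i)) I"
  using bounding_plane_disjoint bounding_plane_nonempty by (force simp: inj_on_def)

text \<open>
  The identity matrix lies in the interior of the cone over \<open>P\<close>, so a small move from it in any
  symmetric direction stays inside that cone.
\<close>

lemma span_P: "span P = Sym"
proof
  have "P \<subseteq> Sym" by (auto simp: mem_P PD_def)
  then show "span P \<subseteq> Sym" by (simp add: span_minimal subspace_Sym)
  show "Sym \<subseteq> span P"
  proof
    fix Z :: "real^'n^'n"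
    assume Z: "Z \<in> Sym"
    obtain e where e: "0 < e" "\<And>t. 0 \<le> t \<Longrightarrow> t \<le> e \<Longrightarrow> posdef (mat 1 + t *\<^sub>R Z)"
      using posdef_perturb[OF posdef_mat_1 Z] by blast
    have "\<forall>\<^sub>F t in at_right 0. 0 < trace (E i) + t * trace (E i ** Z)" if "i \<in> I" for i
    proof -
      have "((\<lambda>t. trace (E i) + t * trace (E i ** Z)) \<longlongrightarrow> trace (E i) + 0 * trace (E i ** Z)) (at_right 0)"
        by (intro tendsto_intros)
      then show ?thesis using trace_E_pos[OF that] by (intro order_tendstoD(1)) auto
    qed
    then have "\<forall>\<^sub>F t in at_right 0. \<forall>i\<in>I. 0 < trace (E i) + t * trace (E i ** Z)"
      by (intro eventually_ball_finite finite_I) auto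
    moreover have "\<forall>\<^sub>F t in at_right 0. t \<in> {0<..<e}"
      by (rule eventually_at_right_real[OF e(1)])
    ultimately have "\<forall>\<^sub>F t in at_right 0. t \<in> {0<..<e} \<and> (\<forall>i\<in>I. 0 < trace (E i) + t * trace (E i ** Z))"
      by (simp add: eventually_conj_iff)
    then obtain t where t: "t \<in> {0<..<e}" "\<forall>i\<in>I. 0 < trace (E i) + t * trace (E i ** Z)"
      using eventually_happens'[OF trivial_limit_at_right_real] by blast
    let ?Y = "mat 1 + t *\<^sub>R Z"
    have pd: "posdef ?Y" using e(2) t(1) by simp
    have in_span: "Y \<in> span P" if Y: "posdef Y" "\<forall>i\<in>I. 0 \<le> trace (E i ** Y)" for Y
    proof -
      obtain c where c: "0 < c" "normalize_det Y = c *\<^sub>R Y"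
        using normalize_det_scaling[OF Y(1)] .
      have "c *\<^sub>R Y \<in> span P" using posdef_mem_P[OF Y(1)] Y(2) c(2) by (simp add: span_base)
      then show ?thesis using c(1) span_scale[of "c *\<^sub>R Y" P "1 / c"] by simp
    qed
    have "?Y \<in> span P"
      using t(2) by (intro in_span pd) (auto simp: trace_mult_add trace_mult_scaleR intro: less_imp_le)
    moreover have "mat 1 \<in> span P"
      using trace_E_pos by (intro in_span posdef_mat_1) (auto intro: less_imp_le)
    ultimately have "(1 / t) *\<^sub>R (?Y - mat 1) \<in> span P"
      by (intro span_scale span_diff)
    then show "Z \<in> span P" using t(1) by simp
  qed
qed

text \<open>The wall spans the whole hyperplane of symmetric matrices with
  \<open>trace (E i ** Z) = 0\<close>, because a point of the wall can be moved slightly in any such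
  direction. One more vector, the identity, then reaches all of \<open>P\<close>. This bound rules
  out walls of codimension 2.\<close>

lemma dim_bounding_plane:
  assumes "i \<in> I"
  shows "dim P \<le> dim (bounding_plane (E i)) + 1"
proof -
  let ?F = "bounding_plane (E i)"
  obtain Q where Q: "Q \<in> ?F" using bounding_plane_nonempty[OF assms] by blast
  then have Q': "posdef Q" "trace (E i ** Q) = 0" by (auto simp: bounding_plane_def PD_iff)
  have in_span: "Z \<in> span ?F" if Z: "Z \<in> Sym" "trace (E i ** Z) = 0" for Z
  proof -
    obtain e where e: "0 < e" "\<And>t. 0 \<le> t \<Longrightarrow> t \<le> e \<Longrightarrow> posdef (Q + t *\<^sub>R Z)"
      using posdef_perturb[OF Q'(1) Z(1)] by blast
    let ?Y = "Q + e *\<^sub>R Z"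
    have pd: "posdef ?Y" using e by simp
    have "trace (E i ** ?Y) = 0" using Q'(2) Z(2) by (simp add: trace_mult_add trace_mult_scaleR)
    then have "normalize_det ?Y \<in> ?F"
      by (simp add: bounding_plane_def normalize_det_PD[OF pd] trace_normalize_det[OF pd])
    moreover obtain c where c: "0 < c" "normalize_det ?Y = c *\<^sub>R ?Y"
      using normalize_det_scaling[OF pd] .
    ultimately have "(1 / c) *\<^sub>R c *\<^sub>R ?Y \<in> span ?F"
      by (metis span_base span_scale)
    then have "?Y \<in> span ?F" using c(1) by simp
    then have "(1 / e) *\<^sub>R (?Y - Q) \<in> span ?F"
      using Q by (intro span_scale span_diff) (auto intro: span_base)
    then show ?thesis using e(1) by simp
  qed
  have "P \<subseteq> span (insert (mat 1) ?F)"
  proof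
    fix Z assume "Z \<in> P"
    then have "Z \<in> Sym" by (simp add: mem_P PD_def)
    \<comment> \<open>Subtracting this multiple of the identity projects \<open>Z\<close> into the
      hyperplane.\<close>
    define c where "c = trace (E i ** Z) / trace (E i)"
    have "trace (E i ** (Z - c *\<^sub>R mat 1)) = 0"
      using trace_E_pos[OF assms] linear_diff[OF linear_trace_mult, of "E i"]
      by (simp add: trace_mult_scaleR c_def)
    then have "Z - c *\<^sub>R mat 1 \<in> span ?F"
      using \<open>Z \<in> Sym\<close> by (intro in_span subspace_diff subspace_scale subspace_Sym mat_1_Sym)
    then show "Z \<in> span (insert (mat 1) ?F)" by (auto simp: span_insert)
  qed
  then have "dim P \<le> dim (insert (mat 1) ?F)"
    by (metis dim_span dim_subset)
  also have "\<dots> \<le> dim ?F + 1" by (simp add: dim_insert)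
  finally show ?thesis .
qed

text \<open>On the segment from \<open>Y\<close> to a matrix with negative value the functional is
  negative at once. Normalizing the determinant keeps the sign and gives a continuous path in
  \<open>PD\<close> that starts at \<open>Y\<close>.\<close>

lemma frontier_point:
  assumes "i \<in> I" "Y \<in> bounding_plane (E i)" "open U" "Y \<in> U"
  shows "\<exists>Z\<in>U \<inter> PD. Z \<notin> P"
proof -
  have Y: "Y \<in> PD" "posdef Y" "trace (E i ** Y) = 0"
    using assms(2) by (auto simp: bounding_plane_def PD_iff)
  obtain W where W: "posdef W" "trace (E i ** W) < 0"
    using ex_negative[OF assms(1)] by blast
  let ?p = "\<lambda>t. (1 - t) *\<^sub>R Y + t *\<^sub>R W"
  have pd: "posdef (?p t)" if "t \<in> {0..1}" for t
    using that by (intro posdef_segment Y W) auto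
  have "continuous_on {0..1} (\<lambda>t. normalize_det (?p t))"
    by (rule continuous_on_compose2[OF continuous_on_normalize_det])
      (auto intro!: continuous_intros pd)
  then have "((\<lambda>t. normalize_det (?p t)) \<longlongrightarrow> normalize_det (?p 0)) (at 0 within {0..1})"
    by (meson atLeastAtMost_iff continuous_on_def order_refl zero_le_one)
  then have "\<forall>\<^sub>F t in at 0 within {0..1}. normalize_det (?p t) \<in> U"
    using assms(3,4) by (intro topological_tendstoD) (simp_all add: normalize_det_eq[OF Y(1)])
  then obtain d where d: "0 < d"
      "\<And>t. t \<in> {0..1} \<Longrightarrow> t \<noteq> 0 \<Longrightarrow> dist t 0 < d \<Longrightarrow> normalize_det (?p t) \<in> U"
    unfolding eventually_at by blast
  define t where "t = min 1 (d / 2)"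
  have t: "t \<in> {0..1}" "0 < t" "dist t 0 < d" using d(1) by (auto simp: t_def)
  have "trace (E i ** ?p t) < 0"
    using Y(3) W(2) t(2) by (simp add: trace_mult_add trace_mult_scaleR mult_less_0_iff)
  then have "normalize_det (?p t) \<notin> P"
    using posdef_mem_P[OF pd[OF t(1)]] assms(1) by (force simp: not_le)
  then show ?thesis
    using d(2)[OF t(1) _ t(3)] t(2) normalize_det_PD[OF pd[OF t(1)]] by blast
qed

text \<open>As \<open>P\<close> spans \<open>Sym\<close>, the relative boundary is the frontier in
  \<open>PD\<close>. \<open>P\<close> is closed there, and \<open>frontier_point\<close> shows that
  its interior is given by the strict inequalities.\<close>

lemma poly_boundary_P: "poly_boundary P = (\<Union>i\<in>I. bounding_plane (E i))"
proof -
  let ?X = "top_of_set PD :: (real^'n^'n) topology"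
  let ?O = "{Y. \<forall>i\<in>I. 0 < trace (E i ** Y)}"
  have "span P \<inter> PD = PD" by (auto simp: span_P PD_def)
  then have eq: "poly_boundary P = ?X frontier_of P" by (simp add: poly_boundary_def)
  have "closed (\<Inter>i\<in>I. {Y. 0 \<le> trace (E i ** Y)})"
    by (intro closed_INT ballI closed_Collect_le continuous_on_trace_mult continuous_on_const)
  then have "closed {Y. \<forall>i\<in>I. 0 \<le> trace (E i ** Y)}"
    by (simp add: INTER_eq)
  moreover have "P = PD \<inter> {Y. \<forall>i\<in>I. 0 \<le> trace (E i ** Y)}" by (auto simp: mem_P)
  ultimately have "closedin ?X P" by (simp add: closedin_closed_Int)
  then have closure: "?X closure_of P = P" by (rule closure_of_closedin)
  have "open (\<Inter>i\<in>I. {Y. 0 < trace (E i ** Y)})"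
    by (intro open_INT ballI open_Collect_less continuous_on_trace_mult continuous_on_const finite_I)
  then have openO: "open ?O" by (simp add: INTER_eq)
  have interior: "?X interior_of P = PD \<inter> ?O"
  proof
    show "PD \<inter> ?O \<subseteq> ?X interior_of P"
      using openO by (intro interior_of_maximal) (auto simp: mem_P order_le_less)
    show "?X interior_of P \<subseteq> PD \<inter> ?O"
    proof
      fix Y assume "Y \<in> ?X interior_of P"
      then obtain T where "openin ?X T" "Y \<in> T" "T \<subseteq> P" unfolding interior_of_def by blast
      then obtain U where U: "open U" "Y \<in> U" "U \<inter> PD \<subseteq> P" "Y \<in> P"
        unfolding openin_open by blast
      then have "Y \<notin> bounding_plane (E i)" if "i \<in> I" for i
        using frontier_point[OF that] by blast
      with \<open>Y \<in> P\<close> show "Y \<in> PD \<inter> ?O"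
        by (fastforce simp: mem_P bounding_plane_def order_le_less)
    qed
  qed
  have "P - PD \<inter> ?O = (\<Union>i\<in>I. bounding_plane (E i))"
  proof
    show "P - PD \<inter> ?O \<subseteq> (\<Union>i\<in>I. bounding_plane (E i))"
      by (fastforce simp: mem_P bounding_plane_def order_le_less)
    show "(\<Union>i\<in>I. bounding_plane (E i)) \<subseteq> P - PD \<inter> ?O"
      using bounding_plane_subset_P by (fastforce simp: bounding_plane_def)
  qed
  then show ?thesis by (simp add: eq frontier_of_def closure interior)
qed

lemma E_nonzero: "i \<in> I \<Longrightarrow> E i \<noteq> 0"
  using trace_E_pos by (force simp: trace_def)

lemma convex_polyhedron_bounding_plane:
  assumes "i \<in> I"
  shows "convex_polyhedron (bounding_plane (E i))"
proof -
  have neg: "trace (- E i ** Y) = - trace (E i ** Y)" for Y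
    by (simp add: trace_def matrix_matrix_mult_def sum_negf)
  have "bounding_plane (E i) = PD \<inter> (\<Inter>A\<in>{E i, - E i}. half_space A)"
    by (auto simp: bounding_plane_def half_space_def neg)
  moreover have "{E i, - E i} \<subseteq> Sym - {0}"
    using E_Sym[OF assms] E_nonzero[OF assms] subspace_neg[OF subspace_Sym] by auto
  moreover have "locally_finite_in (top_of_set PD) (bounding_plane ` {E i, - E i})"
    by (rule finite_imp_locally_finite_in) (auto simp: bounding_plane_def)
  ultimately show ?thesis unfolding convex_polyhedron_def by blast
qed

text \<open>Normalized midpoints are all of convexity that the classification of facets
  uses.\<close>

lemma convex_polyhedron_midpoint:
  assumes "convex_polyhedron G" "Y \<in> G" "Z \<in> G"
  shows "normalize_det (Y + Z) \<in> G"
proof -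
  obtain \<A> where G: "G = PD \<inter> (\<Inter>A\<in>\<A>. half_space A)"
    using assms(1) by (auto simp: convex_polyhedron_def)
  have pd: "posdef (Y + Z)"
    using assms(2,3) by (intro posdef_add) (auto simp: G PD_iff)
  have "0 \<le> trace (A ** (Y + Z))" if "A \<in> \<A>" for A
    using that assms(2,3) by (auto simp: G half_space_def trace_mult_add)
  then have "0 \<le> trace (A ** normalize_det (Y + Z))" if "A \<in> \<A>" for A
    using that by (simp add: trace_normalize_det[OF pd])
  then show ?thesis using normalize_det_PD[OF pd] by (auto simp: G half_space_def)
qed

text \<open>Points on two different walls would have a normalized midpoint on some wall
  \<open>l\<close>. The functional of \<open>l\<close> is nonnegative at both points with sum zero,
  so both lie on \<open>l\<close>, and disjointness of the walls forces a single wall.\<close>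

lemma convex_polyhedron_in_boundary:
  assumes "convex_polyhedron G" "G \<noteq> {}" "G \<subseteq> poly_boundary P"
  obtains i where "i \<in> I" "G \<subseteq> bounding_plane (E i)"
proof -
  obtain Y where "Y \<in> G" using assms(2) by blast
  then obtain i where i: "i \<in> I" "Y \<in> bounding_plane (E i)"
    using assms(3) by (auto simp: poly_boundary_P)
  have "Z \<in> bounding_plane (E i)" if "Z \<in> G" for Z
  proof -
    from \<open>Z \<in> G\<close> obtain j where j: "j \<in> I" "Z \<in> bounding_plane (E j)"
      using assms(3) unfolding poly_boundary_P by blast
    have mid: "normalize_det (Y + Z) \<in> G"
      by (rule convex_polyhedron_midpoint[OF assms(1) \<open>Y \<in> G\<close> \<open>Z \<in> G\<close>])
    have pd: "posdef (Y + Z)"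
      using i(2) j(2) by (intro posdef_add) (auto simp: bounding_plane_def PD_iff)
    obtain l where l: "l \<in> I" "normalize_det (Y + Z) \<in> bounding_plane (E l)"
      using mid assms(3) unfolding poly_boundary_P by blast
    then have "trace (E l ** (Y + Z)) = 0"
      by (simp add: bounding_plane_def trace_normalize_det[OF pd])
    moreover have "0 \<le> trace (E l ** Y)" "0 \<le> trace (E l ** Z)"
      using bounding_plane_nonneg i j l(1) by blast+
    ultimately have "trace (E l ** Y) = 0" "trace (E l ** Z) = 0"
      by (auto simp: trace_mult_add)
    then have "Y \<in> bounding_plane (E l)" "Z \<in> bounding_plane (E l)"
      using i(2) j(2) by (auto simp: bounding_plane_def)
    then show ?thesis using bounding_plane_disjoint i l(1) by blast
  qed
  then show thesis using i(1) that by blast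
qed

text \<open>Every nonempty polyhedron in the boundary sits in one wall. The walls are themselves
  polyhedra, and being nonempty and disjoint, none contains another, so they are the maximal
  ones.\<close>

lemma poly_facet_of_P: "poly_facet_of F P \<longleftrightarrow> (\<exists>i\<in>I. F = bounding_plane (E i))"
proof
  assume F: "poly_facet_of F P"
  then obtain i where i: "i \<in> I" "F \<subseteq> bounding_plane (E i)"
    using convex_polyhedron_in_boundary by (auto simp: poly_facet_of_def)
  moreover have "bounding_plane (E i) \<subseteq> poly_boundary P"
    using i(1) by (auto simp: poly_boundary_P)
  ultimately have "bounding_plane (E i) = F"
    using F convex_polyhedron_bounding_plane[OF i(1)] by (auto simp: poly_facet_of_def)
  with i(1) show "\<exists>i\<in>I. F = bounding_plane (E i)" by blast
next
  assume "\<exists>i\<in>I. F = bounding_plane (E i)"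
  then obtain i where i: "i \<in> I" "F = bounding_plane (E i)" by blast
  have "G = F" if G: "convex_polyhedron G" "F \<subseteq> G" "G \<subseteq> poly_boundary P" for G
  proof -
    obtain j where j: "j \<in> I" "G \<subseteq> bounding_plane (E j)"
      using convex_polyhedron_in_boundary[OF G(1) _ G(3)] G(2) i bounding_plane_nonempty by blast
    with G(2) i have "i = j"
      using bounding_plane_disjoint[of i j] bounding_plane_nonempty[of i] by blast
    with G(2) i j show ?thesis by blast
  qed
  with i show "poly_facet_of F P"
    using bounding_plane_nonempty convex_polyhedron_bounding_plane
    by (auto simp: poly_facet_of_def poly_boundary_P)
qed

lemma card_poly_facets_P: "finite {F. poly_facet_of F P}" "card {F. poly_facet_of F P} = card I"
proof -
  have "{F. poly_facet_of F P} = (\<lambda>i. bounding_plane (E i)) ` I"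
    by (auto simp: poly_facet_of_P)
  then show "finite {F. poly_facet_of F P}" "card {F. poly_facet_of F P} = card I"
    using finite_I card_image[OF inj_on_bounding_plane] by auto
qed

end

text \<open>A wall fills the plane that it spans, and a whole space has empty frontier. As facets
  are nonempty, a wall has none.\<close>

lemma poly_boundary_bounding_plane: "poly_boundary (bounding_plane A) = {}"
proof -
  have "subspace {Y. trace (A ** Y) = 0}"
    by (rule linear_subspace_kernel[OF linear_trace_mult])
  then have "span (bounding_plane A) \<subseteq> {Y. trace (A ** Y) = 0}"
    by (intro span_minimal) (auto simp: bounding_plane_def)
  then have "span (bounding_plane A) \<inter> PD = bounding_plane A"
    using span_superset[of "bounding_plane A"] by (auto simp: bounding_plane_def)
  then show ?thesis
    using frontier_of_topspace[of "top_of_set (bounding_plane A)"] by (simp add: poly_boundary_def)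
qed

context separated_half_spaces
begin

lemma poly_face_of_P: "poly_face_of F P \<Longrightarrow> F = P \<or> (\<exists>i\<in>I. F = bounding_plane (E i))"
proof (induction F P rule: poly_face_of.induct)
  case (facet F G)
  then show ?case
    by (metis poly_boundary_bounding_plane poly_facet_of_P poly_facet_of_def subset_empty)
qed simp

lemma no_ridge_P: "\<not> ridge_of R P"
proof
  assume "ridge_of R P"
  then have face: "poly_face_of R P" and dim: "int (dim R) = int (dim P) - 2"
    by (auto simp: ridge_of_def poly_dim_def)
  from poly_face_of_P[OF face] show False
    using dim dim_bounding_plane by fastforce
qed

end

section \<open>Ping-pong on traces\<close>

lemma act_mult: "act (g ** h) Y = act h (act g Y)"
  by (simp add: act_def matrix_transpose_mul matrix_mul_assoc)

lemma act_mat_1 [simp]: "act (mat 1) Y = Y"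
  by (simp add: act_def)

lemma trace_act: "trace (act g Y) = trace ((g ** transpose g) ** Y)" for g :: "real^'n^'n"
  unfolding act_def using trace_mul_sym[of "transpose g ** Y" g] by (simp add: matrix_mul_assoc)

lemma posdef_act:
  fixes g :: "real^'n^'n"
  assumes "posdef Y" "det g \<noteq> 0"
  shows "posdef (act g Y)"
proof -
  have "v \<bullet> (act g Y *v v) = (g *v v) \<bullet> (Y *v (g *v v))" for v
    by (simp add: act_def inner_commute[of v] dot_lmul_matrix flip: matrix_vector_mul_assoc)
      (rule inner_commute)
  moreover have "g *v v \<noteq> 0" if "v \<noteq> 0" for v
    using assms(2) that invertible_det_nz invertible_left_inverse matrix_left_invertible_ker by blast
  moreover have "act g Y \<in> Sym"
    using assms(1) by (simp add: posdef_def Sym_def act_def matrix_transpose_mul matrix_mul_assoc)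
  ultimately show ?thesis using assms(1) by (simp add: posdef_def)
qed

lemma inner_mult_transpose: "v \<bullet> ((g ** transpose g) *v v) = (norm (v v* g))\<^sup>2" for g :: "real^'n^'n"
  by (simp add: dot_lmul_matrix power2_norm_eq_inner flip: matrix_vector_mul_assoc)

text \<open>The hypothesis says that \<open>g ** transpose g + h ** transpose h\<close> minus four
  times the identity is positive semidefinite, so its product with \<open>Y\<close> has nonnegative
  trace.\<close>

lemma trace_act_expanding:
  fixes g h :: "real^'n^'n"
  assumes "posdef Y" "\<And>v. 4 * (norm v)\<^sup>2 \<le> (norm (v v* g))\<^sup>2 + (norm (v v* h))\<^sup>2"
  shows "4 * trace Y \<le> trace (act g Y) + trace (act h Y)"
proof -
  let ?Q = "g ** transpose g + h ** transpose h + (- 4) *\<^sub>R mat 1 :: real^'n^'n"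
  have Q: "v \<bullet> (?Q *v v) = (norm (v v* g))\<^sup>2 + (norm (v v* h))\<^sup>2 - 4 * (norm v)\<^sup>2" for v
    unfolding inner_matrix_add_scaleR
    unfolding matrix_vector_mult_add_rdistrib inner_add_right inner_mult_transpose
    by (simp add: power2_norm_eq_inner)
  have "0 \<le> trace (?Q ** Y)"
  proof (rule trace_mult_nonneg)
    show "Y \<in> Sym" using assms(1) by (simp add: posdef_def)
    show "0 \<le> v \<bullet> (Y *v v)" for v
      using assms(1) by (cases "v = 0") (auto simp: posdef_def intro: less_imp_le)
    show "0 \<le> v \<bullet> (?Q *v v)" for v unfolding Q using assms(2)[of v] by simp
  qed
  also have "trace (?Q ** Y) = trace (act g Y) + trace (act h Y) - 4 * trace Y"
    unfolding trace_act trace_mul_sym[of _ Y] trace_mult_add trace_mult_scaleR by simp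
  finally show ?thesis by simp
qed

lemma matrix_inv_eqI:
  fixes A B :: "real^'n^'n"
  assumes "A ** B = mat 1"
  shows "matrix_inv A = B"
proof -
  have "\<exists>B. A ** B = mat 1 \<and> B ** A = mat 1"
    using assms matrix_left_right_inverse1[OF assms] by (intro exI[of _ B] conjI)
  then have inv: "matrix_inv A ** A = mat 1"
    unfolding matrix_inv_def by (rule someI2_ex) (elim conjE)
  have "matrix_inv A = matrix_inv A ** (A ** B)" by (simp add: assms)
  also have "\<dots> = B" by (simp only: matrix_mul_assoc inv matrix_mul_lid)
  finally show ?thesis .
qed

lemma selberg_mat_1: "selberg (mat 1) Y = trace Y" for Y :: "real^'n^'n"
  using matrix_inv_eqI[of "mat 1 :: real^'n^'n" "mat 1"] by (simp add: selberg_def)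

lemma SL_simps [simp]:
  "g \<in> carrier SL \<longleftrightarrow> det g = 1" "g \<otimes>\<^bsub>SL\<^esub> h = g ** h" "\<one>\<^bsub>SL\<^esub> = mat 1"
  by (simp_all add: SL_def)

lemma SL_inv:
  assumes "det g = 1"
  shows "det (inv\<^bsub>SL\<^esub> g) = 1" "g ** inv\<^bsub>SL\<^esub> g = mat 1" "inv\<^bsub>SL\<^esub> g ** g = mat 1"
    "inv\<^bsub>SL\<^esub> (inv\<^bsub>SL\<^esub> g) = g"
  using group.inv_closed[OF group_SL, of g] group.r_inv[OF group_SL, of g]
    group.l_inv[OF group_SL, of g] group.inv_inv[OF group_SL, of g] assms by simp_all

text \<open>The inverse of \<open>transpose g ** g\<close> is \<open>h ** transpose h\<close> for
  the inverse \<open>h\<close> of \<open>g\<close>. So the condition that \<open>g\<close> puts on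
  the domain concerns the action of its inverse.\<close>

lemma selberg_act_mat_1:
  assumes "det g = 1"
  shows "selberg (act g (mat 1)) Y = trace (act (inv\<^bsub>SL\<^esub> g) Y)"
proof -
  let ?h = "inv\<^bsub>SL\<^esub> g"
  have "act g (mat 1) ** (?h ** transpose ?h) = transpose g ** (g ** ?h) ** transpose ?h"
    by (simp add: act_def matrix_mul_assoc)
  also have "\<dots> = mat 1"
    using SL_inv(2,3)[OF assms] by (simp flip: matrix_transpose_mul)
  finally show ?thesis by (simp add: selberg_def trace_act matrix_inv_eqI[of "act g (mat 1)" "?h ** transpose ?h"])
qed

text \<open>The bound in \<open>trace_gt\<close> is the trace of the identity: every letter strictly
  increases the trace at the center.\<close>

locale ping_pong =
  fixes T :: "(real^'n^'n) set"
  assumes finite_T: "finite T"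
    and det_T: "g \<in> T \<Longrightarrow> det g = 1"
    and trace_gt: "s \<in> T \<union> m_inv SL ` T \<Longrightarrow> real CARD('n) < trace (act s (mat 1))"
    and expanding: "s \<in> T \<union> m_inv SL ` T \<Longrightarrow> t \<in> T \<union> m_inv SL ` T \<Longrightarrow> s \<noteq> t \<Longrightarrow>
      4 * (norm v)\<^sup>2 \<le> (norm (v v* s))\<^sup>2 + (norm (v v* t))\<^sup>2"
begin

definition S :: "(real^'n^'n) set" where
  "S = T \<union> m_inv SL ` T"

lemma finite_S: "finite S"
  by (simp add: S_def finite_T)

lemma det_S: "s \<in> S \<Longrightarrow> det s = 1"
  using det_T SL_inv(1) by (auto simp: S_def)

lemma inv_S: "s \<in> S \<Longrightarrow> inv\<^bsub>SL\<^esub> s \<in> S"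
  using det_T SL_inv(4) by (auto simp: S_def)

lemma trace_act_separated:
  assumes "s \<in> S" "t \<in> S" "s \<noteq> t" "posdef Y" "trace (act s Y) \<le> trace Y"
  shows "trace Y < trace (act t Y)"
  using trace_act_expanding[OF assms(4) expanding[OF assms(1-3)[unfolded S_def]]]
    trace_posdef_pos[OF assms(4)] assms(5) by simp

lemma trace_mult_act_diff:
  "trace ((s ** transpose s - mat 1) ** Y) = trace (act s Y) - trace Y"
  unfolding trace_act trace_mul_sym[of _ Y] linear_diff[OF linear_trace_mult] by simp

sublocale separated_half_spaces S "\<lambda>s. s ** transpose s - mat 1"
proof
  show "finite S" by (rule finite_S)
  fix s assume s: "s \<in> S"
  show "s ** transpose s - mat 1 \<in> Sym"
    by (intro subspace_diff subspace_Sym mat_1_Sym) (simp add: Sym_def matrix_transpose_mul)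
  show "0 < trace (s ** transpose s - mat 1)"
    using trace_mult_act_diff[of s "mat 1"] trace_gt[OF s[unfolded S_def]] by (simp add: trace_I)
  \<comment> \<open>This matrix has trace above that of the identity, and \<open>s\<close> carries
    it back to the identity.\<close>
  let ?Y = "act (inv\<^bsub>SL\<^esub> s) (mat 1)"
  have "act s ?Y = mat 1"
    using SL_inv(3)[OF det_S[OF s]] by (simp flip: act_mult)
  then have "trace ((s ** transpose s - mat 1) ** ?Y) < 0"
    using trace_gt[OF inv_S[OF s, unfolded S_def]] by (simp add: trace_mult_act_diff trace_I)
  moreover have "posdef ?Y"
    using SL_inv(1)[OF det_S[OF s]] by (intro posdef_act posdef_mat_1) simp
  ultimately show "\<exists>Y. posdef Y \<and> trace ((s ** transpose s - mat 1) ** Y) < 0" by blast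
  fix t Y assume "t \<in> S" "s \<noteq> t" "posdef Y" "trace ((s ** transpose s - mat 1) ** Y) \<le> 0"
  then show "0 < trace ((t ** transpose t - mat 1) ** Y)"
    using trace_act_separated[OF s] by (simp add: trace_mult_act_diff)
qed

text \<open>A reduced word, given by its leading letter and its product. The leading letter is
  recorded because it decides cancellation on the left and, \<open>act\<close> being a right action,
  is the first to act.\<close>

inductive reduced :: "real^'n^'n \<Rightarrow> real^'n^'n \<Rightarrow> bool" where
  letter: "s \<in> S \<Longrightarrow> reduced s s"
| cons: "s \<in> S \<Longrightarrow> t \<noteq> inv\<^bsub>SL\<^esub> s \<Longrightarrow> reduced t w \<Longrightarrow> reduced s (s ** w)"

lemma reduced_letter: "reduced s w \<Longrightarrow> s \<in> S"
  by (auto elim: reduced.cases)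

text \<open>
  If \<open>s\<close> does not decrease the trace of \<open>Y\<close>, then \<open>s\<inverse>\<close> does not increase the trace of
  \<open>act s Y\<close>, so every letter other than \<open>s\<inverse>\<close> increases it.
\<close>

lemma trace_act_reduced:
  "reduced s w \<Longrightarrow> posdef Y \<Longrightarrow> trace Y \<le> trace (act s Y) \<Longrightarrow> trace (act s Y) \<le> trace (act w Y)"
proof (induction arbitrary: Y rule: reduced.induct)
  case (cons s t w)
  let ?Z = "act s Y"
  have pd: "posdef ?Z" using cons.prems(1) det_S[OF cons.hyps(1)] by (simp add: posdef_act)
  have "act (inv\<^bsub>SL\<^esub> s) ?Z = Y"
    using SL_inv(2)[OF det_S[OF cons.hyps(1)]] by (simp flip: act_mult)
  then have "trace ?Z < trace (act t ?Z)"
    using cons.prems(2) cons.hyps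
    by (intro trace_act_separated[OF inv_S[OF cons.hyps(1)] reduced_letter _ pd]) auto
  then show ?case using cons.IH[OF pd] by (simp add: act_mult)
qed simp

text \<open>If the leading letter of \<open>w\<close> is the inverse of \<open>s\<close>, the two
  cancel and leave a shorter reduced word or the identity; otherwise \<open>s\<close> extends the
  word.\<close>

lemma reduced_mult:
  assumes "s \<in> S" "w = mat 1 \<or> (\<exists>t. reduced t w)"
  shows "s ** w = mat 1 \<or> (\<exists>t. reduced t (s ** w))"
proof (cases "\<exists>t. reduced t w")
  case True
  then obtain t where t: "reduced t w" by blast
  show ?thesis
  proof (cases "t = inv\<^bsub>SL\<^esub> s")
    case cancel: True
    have "s ** t = mat 1" using cancel SL_inv(2)[OF det_S[OF assms(1)]] by simp
    with t show ?thesis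
      by (cases rule: reduced.cases) (auto simp: matrix_mul_assoc)
  next
    case False
    show ?thesis using reduced.cons[OF assms(1) False t] by blast
  qed
next
  case False
  with assms(2) have "w = mat 1" by blast
  then show ?thesis using reduced.letter[OF assms(1)] by auto
qed

lemma generate_T_reduced:
  assumes "g \<in> generate SL T"
  shows "g = mat 1 \<or> (\<exists>s. reduced s g)"
proof -
  \<comment> \<open>Stated as stability under left multiplication by \<open>g\<close>, the claim
    passes to products of group elements.\<close>
  from assms have "\<forall>w. w = mat 1 \<or> (\<exists>t. reduced t w) \<longrightarrow>
      g ** w = mat 1 \<or> (\<exists>t. reduced t (g ** w))"
  proof induction
    case (incl h) then show ?case using reduced_mult[of h] by (simp add: S_def)
  next
    case (inv h) then show ?case using reduced_mult[of "inv\<^bsub>SL\<^esub> h"] by (simp add: S_def)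
  next
    case (eng h1 h2) then show ?case by (metis SL_simps(2) matrix_mul_assoc)
  qed simp
  then have "g ** mat 1 = mat 1 \<or> (\<exists>t. reduced t (g ** mat 1))" by blast
  then show ?thesis by simp
qed

lemma subgroup_generate_T: "subgroup (generate SL T) SL"
  using det_T by (intro group.generate_is_subgroup[OF group_SL]) auto

lemma det_generate_T: "g \<in> generate SL T \<Longrightarrow> det g = 1"
  using subgroup.mem_carrier[OF subgroup_generate_T] by auto

lemma S_subset_generate: "S \<subseteq> generate SL T"
  by (auto simp: S_def intro: generate.intros)

lemma DS_generate_T: "DS (mat 1) (generate SL T) = P"
proof
  show "DS (mat 1) (generate SL T) \<subseteq> P"
  proof
    fix Y assume Y: "Y \<in> DS (mat 1) (generate SL T)"
    have "trace Y \<le> trace (act s Y)" if s: "s \<in> S" for s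
      using Y S_subset_generate inv_S[OF s] selberg_act_mat_1[of "inv\<^bsub>SL\<^esub> s" Y]
        SL_inv(1,4)[OF det_S[OF s]]
      by (fastforce simp: DS_def selberg_mat_1)
    with Y show "Y \<in> P" by (simp add: mem_P trace_mult_act_diff DS_def)
  qed
  show "P \<subseteq> DS (mat 1) (generate SL T)"
  proof
    fix Y assume "Y \<in> P"
    then have Y: "Y \<in> PD" "posdef Y" "\<And>s. s \<in> S \<Longrightarrow> trace Y \<le> trace (act s Y)"
      by (auto simp: mem_P trace_mult_act_diff PD_iff)
    have "trace Y \<le> trace (act (inv\<^bsub>SL\<^esub> g) Y)" if "g \<in> generate SL T" for g
    proof -
      have "inv\<^bsub>SL\<^esub> g \<in> generate SL T"
        by (rule subgroup.m_inv_closed[OF subgroup_generate_T that])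
      \<comment> \<open>For the leading letter \<open>s\<close> of a word for the inverse of
        \<open>g\<close>, the trace does not drop from \<open>Y\<close> to \<open>act s Y\<close>,
        nor from there to the full word.\<close>
      from generate_T_reduced[OF this] show ?thesis
        using trace_act_reduced[OF _ Y(2)] Y(3) reduced_letter by fastforce
    qed
    then show "Y \<in> DS (mat 1) (generate SL T)"
      using Y(1) by (simp add: DS_def selberg_mat_1 selberg_act_mat_1 det_generate_T)
  qed
qed

text \<open>Every nontrivial element moves the identity to a matrix of trace at least some
  \<open>m\<close> above that of the identity. Pulling this gap back along the inverse of
  \<open>g\<close> isolates \<open>g\<close>.\<close>

lemma discrete_generate_T: "discrete (generate SL T)"
proof (rule discreteI)
  \<comment> \<open>The inserted value keeps the minimum meaningful when there are no
    letters.\<close>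
  define m where "m = Min (insert (real CARD('n) + 1) ((\<lambda>s. trace (act s (mat 1))) ` S))"
  have m: "real CARD('n) < m"
    using trace_gt finite_S by (auto simp: m_def S_def)
  have m_le: "m \<le> trace (act g (mat 1))" if g: "g \<in> generate SL T" "g \<noteq> mat 1" for g
  proof -
    obtain s where s: "reduced s g" using generate_T_reduced g by blast
    then have "s \<in> S" by (rule reduced_letter)
    then have "m \<le> trace (act s (mat 1))" using finite_S by (auto simp: m_def)
    also have "\<dots> \<le> trace (act g (mat 1))"
      using trace_gt \<open>s \<in> S\<close>
      by (intro trace_act_reduced[OF s posdef_mat_1]) (auto simp: S_def trace_I intro: less_imp_le)
    finally show ?thesis .
  qed
  fix g assume g: "g \<in> generate SL T"
  let ?h = "inv\<^bsub>SL\<^esub> g"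
  let ?U = "{x. trace (act (?h ** x) (mat 1)) < m}"
  have "continuous_on UNIV (\<lambda>x. trace (act (?h ** x) (mat 1)))"
    by (simp add: trace_def act_def matrix_matrix_mult_def transpose_def)
      (intro continuous_intros)
  then have "open ?U" by (intro open_Collect_less continuous_on_const)
  moreover have "?U \<inter> generate SL T = {g}"
  proof
    show "{g} \<subseteq> ?U \<inter> generate SL T"
      using g m SL_inv(3)[OF det_generate_T[OF g]] by (simp add: trace_I)
    show "?U \<inter> generate SL T \<subseteq> {g}"
    proof
      fix x assume x: "x \<in> ?U \<inter> generate SL T"
      then have "?h ** x \<in> generate SL T"
        using subgroup.m_closed[OF subgroup_generate_T subgroup.m_inv_closed[OF subgroup_generate_T g], of x]
        by simp
      then have "?h ** x = mat 1" using m_le x by fastforce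
      then have "x = g"
        by (metis SL_inv(2) det_generate_T g matrix_mul_assoc matrix_mul_lid matrix_mul_rid)
      then show "x \<in> {g}" by simp
    qed
  qed
  ultimately show "g isolated_in generate SL T"
    using g by (auto simp: isolated_in_def)
qed

lemma schottky_generate_T:
  assumes "card S = 2 * k"
  shows "schottky_group k (generate SL T)"
proof -
  have "(mat 1 :: real^'n^'n) \<in> PD" by (simp add: PD_iff posdef_mat_1)
  moreover have "finite {F. poly_facet_of F (DS (mat 1) (generate SL T))}"
    "card {F. poly_facet_of F (DS (mat 1) (generate SL T))} = 2 * k"
    "\<nexists>R. ridge_of R (DS (mat 1) (generate SL T))"
    unfolding DS_generate_T using card_poly_facets_P no_ridge_P assms by auto
  ultimately show ?thesis
    unfolding schottky_group_def discrete_subgroup_def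
    using subgroup_generate_T discrete_generate_T by blast
qed

end

section \<open>Growth under powers\<close>

text \<open>
  The coordinates of \<open>v\<close> in an eigenbasis are scaled by the eigenvalues, so those belonging to
  eigenvalues above 1, which are collected in \<open>L v\<close>, make the orbit of \<open>v\<close> grow.
\<close>

lemma expanding_part:
  fixes f :: "'a::euclidean_space \<Rightarrow> 'a"
  assumes f: "linear f"
    and U: "\<And>v. v \<in> U \<Longrightarrow> \<exists>c>1. f v = c *\<^sub>R v"
    and W: "\<And>v. v \<in> W \<Longrightarrow> \<exists>c. f v = c *\<^sub>R v"
    and span: "span (U \<union> W) = UNIV"
  obtains L :: "'a \<Rightarrow> 'a" where "linear L" "\<And>v. L v = 0 \<Longrightarrow> v \<in> span W"
    "\<And>C. 0 \<le> C \<Longrightarrow> \<forall>\<^sub>F M in sequentially. \<forall>v. C * norm (L v) \<le> norm ((f ^^ M) v)"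
proof -
  \<comment> \<open>Starting the basis inside \<open>W\<close> ensures that each vector added later
    lies in \<open>U\<close>, hence has an eigenvalue above 1.\<close>
  obtain D where D: "D \<subseteq> W" "independent D" "W \<subseteq> span D"
    by (rule maximal_independent_subset)
  obtain B where B: "D \<subseteq> B" "B \<subseteq> U \<union> W" "independent B" "U \<union> W \<subseteq> span B"
    using maximal_independent_subset_extend[of D "U \<union> W"] D by blast
  have finB: "finite B" using B(3) by (rule independent_imp_finite)
  have spanB: "v \<in> span B" for v
    using span_mono[OF B(4)] unfolding span span_span by blast
  have "b \<in> U" if "b \<in> B - D" for b
  proof (rule ccontr)
    assume "b \<notin> U"
    then have "b \<in> span D" using that B(2) D(3) by blast
    then have "b \<in> span (B - {b})" using span_mono[of D "B - {b}"] that B(1) by blast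
    then show False using that B(3) by (auto simp: dependent_def)
  qed
  with U W B(2) have "\<exists>c. f b = c *\<^sub>R b \<and> (b \<in> B - D \<longrightarrow> c > 1)" if "b \<in> B" for b
    using that by (metis Un_iff subsetD)
  then obtain c where c: "\<And>b. b \<in> B \<Longrightarrow> f b = c b *\<^sub>R b" "\<And>b. b \<in> B - D \<Longrightarrow> c b > 1"
    by (metis DiffD1)
  define \<phi> where "\<phi> b v = representation B v b" for b v
  have lin_\<phi>: "linear (\<phi> b)" for b
    by (rule linearI) (simp_all add: \<phi>_def representation_add[OF B(3) spanB spanB]
        representation_scale[OF B(3) spanB])
  have "\<phi> b (f v) = c b * \<phi> b v" if "b \<in> B" for b v
  proof (rule linear_eq_on_span[of "\<lambda>v. \<phi> b (f v)" "\<lambda>v. c b * \<phi> b v" B])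
    show "linear (\<lambda>v. \<phi> b (f v))"
      using linear_compose[OF f lin_\<phi>] by (simp add: o_def)
    show "linear (\<lambda>v. c b * \<phi> b v)"
      using linear_compose_scale_right[OF lin_\<phi>, of "c b" b] by simp
    show "\<phi> b (f x) = c b * \<phi> b x" if "x \<in> B" for x
      using that by (simp add: c(1) linear_cmul[OF lin_\<phi>]) (simp add: \<phi>_def representation_basis[OF B(3)])
  qed (rule spanB)
  then have iterate: "\<phi> b ((f ^^ M) v) = c b ^ M * \<phi> b v" if "b \<in> B" for b v M
    using that by (induction M) auto
  obtain K where K: "\<And>b x. \<bar>\<phi> b x\<bar> \<le> K b * norm x"
    using linear_bounded[OF lin_\<phi>] by (metis real_norm_def)
  define L where "L v = (\<Sum>b\<in>B - D. \<phi> b v *\<^sub>R b)" for v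
  show thesis
  proof (rule that[of L])
    show "linear L"
      unfolding L_def
      by (intro linear_compose_sum ballI linearI)
        (simp_all add: linear_add[OF lin_\<phi>] linear_cmul[OF lin_\<phi>] scaleR_left_distrib)
  next
    fix v assume "L v = 0"
    have "v = (\<Sum>b\<in>B. \<phi> b v *\<^sub>R b)"
      unfolding \<phi>_def by (rule sum_representation_eq[OF B(3) spanB finB subset_refl, symmetric])
    also have "\<dots> = (\<Sum>b\<in>D. \<phi> b v *\<^sub>R b)"
      using sum.subset_diff[OF B(1) finB, of "\<lambda>b. \<phi> b v *\<^sub>R b"] \<open>L v = 0\<close> by (simp add: L_def)
    also have "\<dots> \<in> span W"
      using D(1) by (intro span_sum span_scale span_base) auto
    finally show "v \<in> span W" .
  next
    fix C :: real assume "0 \<le> C"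
    \<comment> \<open>\<open>\<epsilon> M\<close> bounds the norm of \<open>L v\<close> relative to
      that of the \<open>M\<close>-th iterate of \<open>v\<close>, uniformly in \<open>v\<close>,
      and tends to 0.\<close>
    define \<epsilon> where "\<epsilon> M = (\<Sum>b\<in>B - D. K b * norm b * (1 / c b) ^ M)" for M
    have "\<epsilon> \<longlonglongrightarrow> (\<Sum>b\<in>B - D. K b * norm b * 0)"
      unfolding \<epsilon>_def using c(2) by (intro tendsto_intros LIMSEQ_power_zero) fastforce
    then have "(\<lambda>M. C * \<epsilon> M) \<longlonglongrightarrow> C * 0"
      by (intro tendsto_intros) simp
    then have "\<forall>\<^sub>F M in sequentially. C * \<epsilon> M < 1"
      by (intro order_tendstoD(2)) auto
    then show "\<forall>\<^sub>F M in sequentially. \<forall>v. C * norm (L v) \<le> norm ((f ^^ M) v)"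
    proof eventually_elim
      case (elim M)
      show ?case
      proof
        fix v
        have "norm (L v) \<le> (\<Sum>b\<in>B - D. norm (\<phi> b v *\<^sub>R b))"
          unfolding L_def by (rule norm_sum)
        also have "\<dots> \<le> (\<Sum>b\<in>B - D. K b * norm b * (1 / c b) ^ M * norm ((f ^^ M) v))"
        proof (rule sum_mono)
          fix b assume b: "b \<in> B - D"
          have "\<bar>\<phi> b v\<bar> = (1 / c b) ^ M * \<bar>\<phi> b ((f ^^ M) v)\<bar>"
            using b c(2)[OF b] by (simp add: iterate abs_mult field_simps)
          also have "\<dots> \<le> (1 / c b) ^ M * (K b * norm ((f ^^ M) v))"
            using c(2)[OF b] by (intro mult_left_mono K) auto
          finally have "\<bar>\<phi> b v\<bar> * norm b \<le> (1 / c b) ^ M * (K b * norm ((f ^^ M) v)) * norm b"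
            by (intro mult_right_mono) auto
          then show "norm (\<phi> b v *\<^sub>R b) \<le> K b * norm b * (1 / c b) ^ M * norm ((f ^^ M) v)"
            by (simp add: mult_ac)
        qed
        also have "\<dots> = \<epsilon> M * norm ((f ^^ M) v)"
          by (simp add: \<epsilon>_def sum_distrib_right)
        finally have "C * norm (L v) \<le> C * (\<epsilon> M * norm ((f ^^ M) v))"
          using \<open>0 \<le> C\<close> by (rule mult_left_mono)
        also have "\<dots> \<le> 1 * norm ((f ^^ M) v)"
          using elim unfolding mult.assoc[symmetric] by (intro mult_right_mono) auto
        finally show "C * norm (L v) \<le> norm ((f ^^ M) v)" by simp
      qed
    qed
  qed
qed

text \<open>The kernels of \<open>L\<close> and \<open>L'\<close> meet trivially, so the pair
  \<open>(L v, L' v)\<close> is bounded below by a multiple of \<open>norm v\<close>: each vector is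
  expanded by one map or the other.\<close>

lemma eventually_pair_expanding:
  fixes f g L L' :: "'a::euclidean_space \<Rightarrow> 'a"
  assumes "linear L" "linear L'" "\<And>v. L v = 0 \<Longrightarrow> L' v = 0 \<Longrightarrow> v = 0"
    and f: "\<And>C. 0 \<le> C \<Longrightarrow> \<forall>\<^sub>F M in sequentially. \<forall>v. C * norm (L v) \<le> norm ((f ^^ M) v)"
    and g: "\<And>C. 0 \<le> C \<Longrightarrow> \<forall>\<^sub>F M in sequentially. \<forall>v. C * norm (L' v) \<le> norm ((g ^^ M) v)"
  shows "\<forall>\<^sub>F M in sequentially. \<forall>v. 4 * (norm v)\<^sup>2 \<le> (norm ((f ^^ M) v))\<^sup>2 + (norm ((g ^^ M) v))\<^sup>2"
proof -
  let ?p = "\<lambda>v. (L v, L' v)"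
  have lin: "linear ?p"
    using assms(1,2) by (auto intro!: linearI simp: linear_add linear_cmul)
  then have "inj ?p"
    using assms(3) by (simp add: linear_injective_0 zero_prod_def)
  then obtain \<kappa> where \<kappa>: "\<kappa> > 0" "\<And>v. \<kappa> * norm v \<le> norm (?p v)"
    using linear_inj_bounded_below_pos[OF lin] by blast
  \<comment> \<open>The 2 squares to the factor 4, and dividing by \<open>\<kappa>\<close> cancels
    the lower bound for the pair.\<close>
  have "0 \<le> 2 / \<kappa>" using \<kappa>(1) by simp
  from f[OF this] g[OF this] show ?thesis
  proof eventually_elim
    case (elim M)
    show ?case
    proof
      fix v
      have "norm v \<le> norm (?p v) / \<kappa>" using \<kappa> by (simp add: field_simps)
      then have "(norm v)\<^sup>2 \<le> (norm (?p v) / \<kappa>)\<^sup>2" by (intro power_mono) auto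
      then have "4 * (norm v)\<^sup>2 \<le> (2 / \<kappa> * norm (L v))\<^sup>2 + (2 / \<kappa> * norm (L' v))\<^sup>2"
        by (simp add: norm_Pair power_divide power_mult_distrib add_divide_distrib)
      also have "\<dots> \<le> (norm ((f ^^ M) v))\<^sup>2 + (norm ((g ^^ M) v))\<^sup>2"
        using elim \<kappa>(1) by (intro add_mono power_mono) auto
      finally show "4 * (norm v)\<^sup>2 \<le> (norm ((f ^^ M) v))\<^sup>2 + (norm ((g ^^ M) v))\<^sup>2" .
    qed
  qed
qed

section \<open>Projective subspaces, complements and matrix powers\<close>

lemma Union_projectivization: "subspace V \<Longrightarrow> insert 0 (\<Union>(projectivization V)) = V"
  by (auto simp: projectivization_def span_singleton subspace_0 subspace_scale)
    (metis (no_types) UNIV_I image_eqI scaleR_one)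

text \<open>The union of the lines is the subspace itself, except that it is empty for the zero
  subspace. Inserting 0 covers that case without changing the dimension.\<close>

lemma dim_projectivization: "subspace V \<Longrightarrow> proj_dim (projectivization V) = int (dim V) - 1"
  
  using dim_insert[of 0 "\<Union>(projectivization V)"] Union_projectivization[of V]
  by (simp add: proj_dim_def span_0)

lemma projectivization_disjoint:
  "projectivization V \<inter> projectivization W = {} \<Longrightarrow> v \<in> V \<Longrightarrow> v \<in> W \<Longrightarrow> v = 0"
  by (auto simp: projectivization_def)

lemma span_Un_full:
  fixes U W :: "'a::euclidean_space set"
  assumes "span U \<inter> span W \<subseteq> {0}" "dim U + dim W = DIM('a)"
  shows "span (U \<union> W) = UNIV"
proof -
  have "span U \<inter> span W = {0}" using assms(1) span_0 by blast
  then have "dim {x + y |x y. x \<in> span U \<and> y \<in> span W} = DIM('a)"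
    using dim_sums_Int[of "span U" "span W"] assms(2) by simp
  moreover have "{x + y |x y. x \<in> span U \<and> y \<in> span W} = span (U \<union> W)"
    by (auto simp: span_Un)
  ultimately show ?thesis using dim_eq_full[of "span (U \<union> W)"] by (simp add: span_span)
qed

lemma vector_matrix_mult_nat_pow: "v v* (A [^]\<^bsub>SL\<^esub> (M::nat)) = ((\<lambda>v. v v* A) ^^ M) v"
  for A :: "real^'n^'n"
proof (induction M arbitrary: v)
  case 0
  then show ?case by (simp add: SL_def nat_pow_def)
next
  case (Suc M)
  have "v v* (A [^]\<^bsub>SL\<^esub> Suc M) = (v v* (A [^]\<^bsub>SL\<^esub> M)) v* A"
    by (simp add: vector_matrix_mul_assoc)
  then show ?case by (simp add: Suc)
qed

lemma trace_act_mat_1: "trace (act g (mat 1)) = (\<Sum>i\<in>UNIV. (norm (axis i 1 v* g))\<^sup>2)"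
  for g :: "real^'n^'n"
proof -
  have "(g ** transpose g) $ i $ i = axis i 1 \<bullet> ((g ** transpose g) *v axis i 1)" for i
    by (simp only: inner_axis' matrix_vector_mult_basis) (simp add: column_def)
  then show ?thesis unfolding trace_act matrix_mul_rid by (simp add: trace_def inner_mult_transpose)
qed

lemma eventually_trace_gt:
  fixes A :: "real^'n^'n" and L :: "real^'n \<Rightarrow> real^'n"
  assumes "linear L" "L v \<noteq> 0"
    and L: "\<And>C. 0 \<le> C \<Longrightarrow> \<forall>\<^sub>F M in sequentially. \<forall>v. C * norm (L v) \<le> norm (((\<lambda>v. v v* A) ^^ M) v)"
  shows "\<forall>\<^sub>F M in sequentially. r < trace (act (A [^]\<^bsub>SL\<^esub> (M::nat)) (mat 1))"
proof -
  obtain i where i: "L (axis i 1) \<noteq> 0"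
  proof -
    have "\<exists>b\<in>Basis. L b \<noteq> 0"
      using linear_eq_stdbasis[OF assms(1) linear_zero] assms(2) by fastforce
    then show thesis using that by (auto simp: Basis_vec_def)
  qed
  let ?e = "axis i 1 :: real^'n"
  \<comment> \<open>The trace is the sum of the squared norms of the rows. This factor makes one row
    at least \<open>\<bar>r\<bar> + 1\<close> long, and since that is at least 1, its square still
    exceeds \<open>r\<close>.\<close>
  have "0 \<le> (\<bar>r\<bar> + 1) / norm (L ?e)" by simp
  from L[OF this] show ?thesis
  proof eventually_elim
    case (elim M)
    have "r < \<bar>r\<bar> + 1" by linarith
    also have "\<dots> \<le> (\<bar>r\<bar> + 1)\<^sup>2" by (rule self_le_power) auto
    finally have "r < (\<bar>r\<bar> + 1)\<^sup>2" .
    moreover have "\<bar>r\<bar> + 1 \<le> norm (?e v* (A [^]\<^bsub>SL\<^esub> M))"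
      using spec[OF elim, of ?e] i by (simp add: vector_matrix_mult_nat_pow)
    then have "(\<bar>r\<bar> + 1)\<^sup>2 \<le> (norm (?e v* (A [^]\<^bsub>SL\<^esub> M)))\<^sup>2"
      by (intro power_mono) auto
    moreover have "(norm (?e v* (A [^]\<^bsub>SL\<^esub> M)))\<^sup>2 \<le> trace (act (A [^]\<^bsub>SL\<^esub> M) (mat 1))"
      unfolding trace_act_mat_1 by (rule member_le_sum) auto
    ultimately show ?case by linarith
  qed
qed

lemma eigenvector_inverse:
  fixes B C :: "real^'n^'n"
  assumes "B ** C = mat 1"
  shows "eigenvector B v c \<Longrightarrow> c \<noteq> 0 \<Longrightarrow> eigenvector C v (1 / c)"
proof -
  assume v: "eigenvector B v c" "c \<noteq> 0"
  have "C *v (B *v v) = v"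
    using matrix_left_right_inverse1[OF assms] by (simp add: matrix_vector_mul_assoc)
  then have "c *\<^sub>R (C *v v) = v"
    using v(1) by (simp add: eigenvector_def scalar_mult_eq_scaleR matrix_vector_mult_scaleR)
  then have "C *v v = (1 / c) *\<^sub>R v" using v(2) by (metis divide_self_if one_neq_zero scaleR_one scaleR_scaleR times_divide_eq_left mult_1)
  then show "eigenvector C v (1 / c)"
    using v(1) by (simp add: eigenvector_def scalar_mult_eq_scaleR)
qed

lemma expanding_part_matrix:
  fixes G :: "real^'n^'n"
  assumes U: "\<And>v. v \<in> U \<Longrightarrow> \<exists>c>1. eigenvector (transpose G) v c"
    and W: "\<And>v. v \<in> W \<Longrightarrow> \<exists>c. eigenvector (transpose G) v c"
    and span: "span (U \<union> W) = UNIV"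
  shows "\<exists>L :: real^'n \<Rightarrow> real^'n. linear L \<and> (\<forall>v. L v = 0 \<longrightarrow> v \<in> span W) \<and>
    (\<forall>C\<ge>0. \<forall>\<^sub>F M in sequentially. \<forall>v. C * norm (L v) \<le> norm (((\<lambda>v. v v* G) ^^ M) v))"
proof (rule expanding_part[of "\<lambda>v. v v* G" U W])
  show "linear (\<lambda>v. v v* G)"
    using matrix_vector_mul_linear[of "transpose G"] by simp
  show "\<exists>c>1. v v* G = c *\<^sub>R v" if "v \<in> U" for v
    using U[OF that] by (auto simp: eigenvector_def scalar_mult_eq_scaleR)
  show "\<exists>c. v v* G = c *\<^sub>R v" if "v \<in> W" for v
    using W[OF that] by (auto simp: eigenvector_def scalar_mult_eq_scaleR)
  show "span (U \<union> W) = UNIV" by (rule span)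
  fix L :: "real^'n \<Rightarrow> real^'n"
  assume "linear L" "\<And>v. L v = 0 \<Longrightarrow> v \<in> span W"
    "\<And>C. 0 \<le> C \<Longrightarrow> \<forall>\<^sub>F M in sequentially. \<forall>v. C * norm (L v) \<le> norm (((\<lambda>v. v v* G) ^^ M) v)"
  then show ?thesis by (intro exI[of _ L]) simp
qed

theorem theorem7p1:
  fixes n k :: nat
    and A :: "nat \<Rightarrow> real^'N^'N"
  assumes "CARD('N) = 2 * n"
    and "\<And>i. i \<in> {1..k} \<Longrightarrow> A i \<in> carrier SL"
    and "\<And>i. i \<in> {1..k} \<Longrightarrow> only_positive_eigenvalues (A i)"
    and "\<And>i. i \<in> {1..k} \<Longrightarrow> proj_dim (attracting (A i)) = int n - 1"
    and "\<And>i. i \<in> {1..k} \<Longrightarrow> proj_dim (repulsing (A i)) = int n - 1"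
    and "\<And>i j. i \<in> {1..k} \<Longrightarrow> j \<in> {1..k} \<Longrightarrow> i \<noteq> j \<Longrightarrow>
           attracting (A i) \<inter> attracting (A j) = {}"
    and "\<And>i j. i \<in> {1..k} \<Longrightarrow> j \<in> {1..k} \<Longrightarrow> i \<noteq> j \<Longrightarrow>
           repulsing (A i) \<inter> repulsing (A j) = {}"
    and "\<And>i j. i \<in> {1..k} \<Longrightarrow> j \<in> {1..k} \<Longrightarrow>
           attracting (A i) \<inter> repulsing (A j) = {}"
  shows "\<exists>M::nat. M > 0 \<and>
           schottky_group k (generate SL {A i [^]\<^bsub>SL\<^esub> M | i. i \<in> {1..k}})"
proof -
  define U where "U i = {v. \<exists>c>1. eigenvector (transpose (A i)) v c}" for i
  define W where "W i = {v. \<exists>c. 0 < c \<and> c < 1 \<and> eigenvector (transpose (A i)) v c}" for i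
  have attr: "attracting (A i) = projectivization (span (U i))"
    and rep: "repulsing (A i) = projectivization (span (W i))" for i
    by (simp_all add: attracting_def repulsing_def U_def W_def)
  \<comment> \<open>The letters: \<open>True\<close> marks \<open>A i\<close>, \<open>False\<close>
    its inverse.\<close>
  define J where "J = {1..k} \<times> (UNIV :: bool set)"
  have finite_J: "finite J" by (simp add: J_def)
  define G where "G j = (if snd j then A (fst j) else inv\<^bsub>SL\<^esub> A (fst j))" for j
  \<comment> \<open>The space that letter \<open>j\<close> contracts: repulsing for
    \<open>A i\<close>, attracting for the inverse, whose eigenvalues are the reciprocals.\<close>
  define K where "K j = span (if snd j then W (fst j) else U (fst j))" for j
  have det_A: "det (A i) = 1" if "i \<in> {1..k}" for i
    using assms(2)[OF that] by simp
  have dim_K: "dim (K j) = n" if "j \<in> J" for j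
    using that assms(4,5) by (auto simp: attr rep K_def dim_projectivization J_def)
  have K_disjoint: "v = 0" if "j \<in> J" "l \<in> J" "j \<noteq> l" "v \<in> K j" "v \<in> K l" for j l v
  proof -
    have "projectivization (K j) \<inter> projectivization (K l) = {}"
      using that(1-3) assms(6-8)[of "fst j" "fst l"] assms(8)[of "fst l" "fst j"]
      by (cases j; cases l) (auto simp: attr rep K_def J_def split: if_splits)
    then show ?thesis using that(4,5) by (rule projectivization_disjoint)
  qed
  have "\<exists>L :: real^'N \<Rightarrow> real^'N. linear L \<and> (\<forall>v. L v = 0 \<longrightarrow> v \<in> K j) \<and>
      (\<forall>C\<ge>0. \<forall>\<^sub>F M in sequentially. \<forall>v. C * norm (L v) \<le> norm (((\<lambda>v. v v* G j) ^^ M) v))"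
    if "j \<in> J" for j
  proof -
    obtain i b where j: "j = (i, b)" "i \<in> {1..k}" using \<open>j \<in> J\<close> by (auto simp: J_def)
    have "span (U i \<union> W i) = UNIV"
      using K_disjoint[of "(i, True)" "(i, False)"] dim_K[of "(i, True)"] dim_K[of "(i, False)"] j(2) assms(1)
      by (intro span_Un_full) (auto simp: K_def J_def)
    then have full: "span (U i \<union> W i) = UNIV" "span (W i \<union> U i) = UNIV"
      by (simp_all add: Un_commute)
    have inverse: "transpose (A i) ** transpose (inv\<^bsub>SL\<^esub> A i) = mat 1"
      using SL_inv(3)[OF det_A[OF j(2)]] by (simp flip: matrix_transpose_mul)
    show ?thesis
    proof (cases b)
      case True
      have "\<exists>c>1. eigenvector (transpose (A i)) v c" if "v \<in> U i" for v
        using that by (simp add: U_def)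
      moreover have "\<exists>c. eigenvector (transpose (A i)) v c" if "v \<in> W i" for v
        using that by (auto simp: W_def)
      moreover have "G j = A i" "K j = span (W i)"
        by (simp_all add: G_def K_def j(1) True)
      ultimately show ?thesis
        using expanding_part_matrix[OF _ _ full(1), of "A i"] by simp
    next
      case False
      have "\<exists>c>1. eigenvector (transpose (inv\<^bsub>SL\<^esub> A i)) v c" if v: "v \<in> W i" for v
      proof -
        obtain c where "0 < c" "c < 1" "eigenvector (transpose (A i)) v c"
          using v by (auto simp: W_def)
        then show ?thesis
          using eigenvector_inverse[OF inverse, of v c] by (intro exI[of _ "1 / c"]) auto
      qed
      moreover have "\<exists>c. eigenvector (transpose (inv\<^bsub>SL\<^esub> A i)) v c" if "v \<in> U i" for v
        using that eigenvector_inverse[OF inverse, of v] by (force simp: U_def)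
      moreover have "G j = inv\<^bsub>SL\<^esub> A i" "K j = span (U i)"
        by (simp_all add: G_def K_def j(1) False)
      ultimately show ?thesis
        using expanding_part_matrix[OF _ _ full(2), of "inv\<^bsub>SL\<^esub> A i"] by simp
    qed
  qed
  then have "\<forall>j\<in>J. \<exists>L :: real^'N \<Rightarrow> real^'N. linear L \<and> (\<forall>v. L v = 0 \<longrightarrow> v \<in> K j) \<and>
      (\<forall>C\<ge>0. \<forall>\<^sub>F M in sequentially. \<forall>v. C * norm (L v) \<le> norm (((\<lambda>v. v v* G j) ^^ M) v))"
    by (rule ballI)
  from bchoice[OF this] obtain L :: "nat \<times> bool \<Rightarrow> real^'N \<Rightarrow> real^'N" where
    "\<forall>j\<in>J. linear (L j) \<and> (\<forall>v. L j v = 0 \<longrightarrow> v \<in> K j) \<and>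
      (\<forall>C\<ge>0. \<forall>\<^sub>F M in sequentially. \<forall>v. C * norm (L j v) \<le> norm (((\<lambda>v. v v* G j) ^^ M) v))" ..
  then have L: "linear (L j)" "L j v = 0 \<Longrightarrow> v \<in> K j"
    "0 \<le> C \<Longrightarrow> \<forall>\<^sub>F M in sequentially. \<forall>v. C * norm (L j v) \<le> norm (((\<lambda>v. v v* G j) ^^ M) v)"
    if "j \<in> J" for j v C
    using that by simp_all
  have trace_gt: "\<forall>\<^sub>F M in sequentially. \<forall>j\<in>J.
      real CARD('N) < trace (act (G j [^]\<^bsub>SL\<^esub> (M::nat)) (mat 1))"
  proof (intro eventually_ball_finite ballI)
    fix j assume j: "j \<in> J"
    \<comment> \<open>The matrix size is positive, so \<open>n\<close> is too and the contracted
      space is proper: some vector grows.\<close>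
    have "n < CARD('N)"
      using assms(1) zero_less_card_finite[where 'a = 'N] by linarith
    then have "K j \<noteq> UNIV" using dim_K[OF j] by auto
    then obtain v where "L j v \<noteq> 0" using L(2)[OF j] by blast
    then show "\<forall>\<^sub>F M in sequentially. real CARD('N) < trace (act (G j [^]\<^bsub>SL\<^esub> (M::nat)) (mat 1))"
      using eventually_trace_gt[OF L(1)[OF j]] L(3)[OF j] by blast
  qed (rule finite_J)
  have expanding: "\<forall>\<^sub>F M in sequentially. \<forall>j\<in>J. \<forall>l\<in>J. j \<noteq> l \<longrightarrow> (\<forall>v.
      4 * (norm v)\<^sup>2 \<le> (norm (v v* (G j [^]\<^bsub>SL\<^esub> (M::nat))))\<^sup>2 + (norm (v v* (G l [^]\<^bsub>SL\<^esub> M)))\<^sup>2)"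
  proof (intro eventually_ball_finite finite_J ballI)
    fix j l assume jl: "j \<in> J" "l \<in> J"
    show "\<forall>\<^sub>F M in sequentially. j \<noteq> l \<longrightarrow> (\<forall>v.
      4 * (norm v)\<^sup>2 \<le> (norm (v v* (G j [^]\<^bsub>SL\<^esub> (M::nat))))\<^sup>2 + (norm (v v* (G l [^]\<^bsub>SL\<^esub> M)))\<^sup>2)"
    proof (cases "j = l")
      case False
      have "\<forall>\<^sub>F M in sequentially. \<forall>v.
        4 * (norm v)\<^sup>2 \<le> (norm (v v* (G j [^]\<^bsub>SL\<^esub> (M::nat))))\<^sup>2 + (norm (v v* (G l [^]\<^bsub>SL\<^esub> M)))\<^sup>2"
        unfolding vector_matrix_mult_nat_pow
        using K_disjoint[OF jl False] L(2)[OF jl(1)] L(2)[OF jl(2)]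
        by (intro eventually_pair_expanding[OF L(1)[OF jl(1)] L(1)[OF jl(2)] _
              L(3)[OF jl(1)] L(3)[OF jl(2)]]) blast
      then show ?thesis by (rule eventually_mono) blast
    qed simp
  qed
  \<comment> \<open>Finitely many eventual conditions share one exponent.\<close>
  have "\<exists>M>0. (\<forall>j\<in>J. real CARD('N) < trace (act (G j [^]\<^bsub>SL\<^esub> M) (mat 1))) \<and>
      (\<forall>j\<in>J. \<forall>l\<in>J. j \<noteq> l \<longrightarrow> (\<forall>v.
        4 * (norm v)\<^sup>2 \<le> (norm (v v* (G j [^]\<^bsub>SL\<^esub> (M::nat))))\<^sup>2 + (norm (v v* (G l [^]\<^bsub>SL\<^esub> M)))\<^sup>2))"
    by (rule eventually_happens'[OF sequentially_bot
          eventually_conj[OF eventually_gt_at_top eventually_conj[OF trace_gt expanding]]])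
  then obtain M :: nat where "0 < M"
    and M: "\<forall>j\<in>J. real CARD('N) < trace (act (G j [^]\<^bsub>SL\<^esub> M) (mat 1))"
    "\<forall>j\<in>J. \<forall>l\<in>J. j \<noteq> l \<longrightarrow> (\<forall>v.
      4 * (norm v)\<^sup>2 \<le> (norm (v v* (G j [^]\<^bsub>SL\<^esub> (M::nat))))\<^sup>2 + (norm (v v* (G l [^]\<^bsub>SL\<^esub> M)))\<^sup>2)"
    by (elim exE conjE)
  define T where "T = {A i [^]\<^bsub>SL\<^esub> M | i. i \<in> {1..k}}"
  have pow_inv: "inv\<^bsub>SL\<^esub> (A i [^]\<^bsub>SL\<^esub> M) = G (i, False) [^]\<^bsub>SL\<^esub> M" if "i \<in> {1..k}" for i
    using group.nat_pow_inv[OF group_SL, of "A i" M] det_A[OF that] by (simp add: G_def)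
  have letters: "T \<union> m_inv SL ` T = (\<lambda>j. G j [^]\<^bsub>SL\<^esub> M) ` J"
  proof -
    have "T = (\<lambda>j. G j [^]\<^bsub>SL\<^esub> M) ` ({1..k} \<times> {True})"
      by (force simp: T_def G_def)
    moreover have "m_inv SL ` T = (\<lambda>j. G j [^]\<^bsub>SL\<^esub> M) ` ({1..k} \<times> {False})"
      using pow_inv by (force simp: T_def)
    ultimately show ?thesis by (simp add: J_def UNIV_bool flip: image_Un) (force)
  qed
  have det_pow: "det (G j [^]\<^bsub>SL\<^esub> M) = 1" if "j \<in> J" for j
  proof -
    have "G j \<in> carrier SL" using that by (auto simp: G_def J_def det_A SL_inv(1))
    then show ?thesis
      using monoid.nat_pow_closed[OF group.is_monoid[OF group_SL], of "G j" M] by simp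
  qed
  interpret ping_pong T
  proof
    show "finite T" by (simp add: T_def)
    fix g assume "g \<in> T"
    then have "g \<in> (\<lambda>j. G j [^]\<^bsub>SL\<^esub> M) ` J" unfolding letters[symmetric] by (rule UnI1)
    then obtain j where "g = G j [^]\<^bsub>SL\<^esub> M" "j \<in> J" ..
    then show "det g = 1" by (simp add: det_pow)
  next
    fix s assume "s \<in> T \<union> m_inv SL ` T"
    then obtain j where s: "s = G j [^]\<^bsub>SL\<^esub> M" "j \<in> J" unfolding letters ..
    then show "real CARD('N) < trace (act s (mat 1))" using M(1) by simp
    fix t v assume "t \<in> T \<union> m_inv SL ` T" "s \<noteq> t"
    then obtain l where t: "t = G l [^]\<^bsub>SL\<^esub> M" "l \<in> J" unfolding letters by (elim imageE)
    then have "j \<noteq> l" using s \<open>s \<noteq> t\<close> by auto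
    then show "4 * (norm v)\<^sup>2 \<le> (norm (v v* s))\<^sup>2 + (norm (v v* t))\<^sup>2"
      using M(2) s t by simp
  qed
  have "inj_on (\<lambda>j. G j [^]\<^bsub>SL\<^esub> M) J"
  proof (rule inj_onI, rule ccontr)
    fix j l assume j: "j \<in> J" "l \<in> J" "G j [^]\<^bsub>SL\<^esub> M = G l [^]\<^bsub>SL\<^esub> M" "j \<noteq> l"
    let ?s = "G j [^]\<^bsub>SL\<^esub> M"
    have "?s \<in> S" unfolding S_def letters using j(1) by (rule imageI)
    then obtain Y where Y: "posdef Y" "trace ((?s ** transpose ?s - mat 1) ** Y) < 0"
      using ex_negative by blast
    \<comment> \<open>If two indices gave the same matrix, the bound for that pair would make it at
      least double every trace, yet it lowers the trace of \<open>Y\<close>.\<close>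
    have "4 * trace Y \<le> trace (act ?s Y) + trace (act ?s Y)"
      by (rule trace_act_expanding[OF Y(1)]) (use M(2) j in force)
    then show False using Y(2) trace_posdef_pos[OF Y(1)] by (simp add: trace_mult_act_diff)
  qed
  then have "card S = 2 * k"
    unfolding S_def letters by (simp add: card_image card_cartesian_product J_def)
  then have "schottky_group k (generate SL T)" by (rule schottky_generate_T)
  with \<open>0 < M\<close> show ?thesis unfolding T_def by blast
qed

end
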